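(* Let $A$ be a real $d\times d$ matrix all of whose eigenvalues have strictly negative real parts, let $B$ be a real $d\times m$ matrix such that $(A,B)$ is a controllable pair, and let $a\in\mathbb{R}^d$, $\gamma\in\mathbb{R}^m$. Let $v$ be the stationary solution of $dv(t)=Av(t)\,dt+B\,dW(t)$, $t\in\mathbb{R}$. Let $\psi:\mathbb{R}\to[0,\infty)$ be piecewise continuous with support in $[-1,1]$ and $\int_{-\infty}^\infty\psi(t)\,dt=1$, and for $\delta>0$ let $\psi_\delta(t)=(1/\delta)\psi(t/\delta)$ and $$\xi_\delta(t)=\int_{-\infty}^\infty\langle a,v(s)\rangle\psi_\delta(t-s)\,ds+\Bigl\langle\gamma,\int_{-\infty}^\infty\psi_\delta(t-s)\,dW(s)\Bigr\rangle .$$ Then for every $\omega$ the limit $$\lim_{\delta\to0}S_{\xi_\delta}(\omega)=\langle a,\widehat S_A(\omega)Ra\rangle+\langle a,\widehat S_A(\omega)B\gamma\rangle+\frac{\|\gamma\|^2}{2\pi}$$ exists and does not depend on the choice of $\psi$. Defining $S_\xi(\omega):=\lim_{\delta\to0}S_{\xi_\delta}(\omega)$, we have, for $\omega\ne0$, $$\lambda_2(\omega)=\frac{\pi}{\omega^2}S_\xi(\omega).$$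
   Context: $W$ is a standard $m$-dimensional Brownian motion indexed by $\mathbb{R}$. $(A,B)$ is a controllable pair if $\mathrm{rank}\{B,AB,\dots,A^{d-1}B\}=d$. The stationary solution is $v(t)=\int_{-\infty}^te^{(t-s)A}B\,dW(s)$; its covariance matrix is $R=\int_0^\infty e^{tA}BB^*e^{tA^*}\,dt$. The matrix valued cosine transform of $A$ is $\widehat S_A(\omega)=\frac1\pi\int_0^\infty e^{tA}\cos\omega t\,dt$. For an $L^2$ stationary mean-zero scalar process $X$, the power spectral density is $S_X(\omega)=\frac1{2\pi}\int_{-\infty}^\infty\mathbb{E}[X(t)X(0)]e^{-i\omega t}\,dt=\frac1\pi\int_0^\infty\mathbb{E}[X(t)X(0)]\cos\omega t\,dt$. By definition $\lambda_2(\omega)=\frac{\pi}{\omega^2}\bigl(\langle a,\widehat S_A(\omega)Ra\rangle+\langle a,\widehat S_A(\omega)B\gamma\rangle+\frac{\|\gamma\|^2}{2\pi}\bigr)$ for $\omega\ne0$. The process $\xi_\delta$ is a mollification of the generalized process $\xi(t)=\langle a,v(t)\rangle+\langle\gamma,\dot W(t)\rangle$. *)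

theory Defs
  imports "HOL-Probability.Probability"
begin

section \<open>Matrices\<close>

text \<open>The componentwise type-class product on \<open>real ^ 'n ^ 'n\<close> is not the matrix product,
  so matrix powers and the matrix exponential are set up explicitly.\<close>

definition matpow :: "real ^ 'n ^ 'n \<Rightarrow> nat \<Rightarrow> real ^ 'n ^ 'n" where
  "matpow A k = (((**) A) ^^ k) (mat 1)"

definition mexp :: "real ^ 'n ^ 'n \<Rightarrow> real ^ 'n ^ 'n" where
  "mexp A = (\<Sum>k. (1 / fact k) *\<^sub>R matpow A k)"

definition complex_eigenvalue :: "real ^ 'n ^ 'n \<Rightarrow> complex \<Rightarrow> bool" where
  "complex_eigenvalue A z \<longleftrightarrow>
     (\<exists>x :: complex ^ 'n. x \<noteq> 0 \<and> map_matrix complex_of_real A *v x = z *s x)"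

definition stable_matrix :: "real ^ 'n ^ 'n \<Rightarrow> bool" where
  "stable_matrix A \<longleftrightarrow> (\<forall>z. complex_eigenvalue A z \<longrightarrow> Re z < 0)"

text \<open>The rank of the block matrix with blocks \<open>B, AB, \<dots>, A\<^sup>d\<^sup>-\<^sup>1B\<close>, written as the dimension
  of the span of all its columns.\<close>

definition controllable :: "real ^ 'd ^ 'd \<Rightarrow> real ^ 'm ^ 'd \<Rightarrow> bool" where
  "controllable A B \<longleftrightarrow> dim (\<Union>k<CARD('d). columns (matpow A k ** B)) = CARD('d)"

definition stationary_cov :: "real ^ 'd ^ 'd \<Rightarrow> real ^ 'm ^ 'd \<Rightarrow> real ^ 'd ^ 'd" where
  "stationary_cov A B =
     (LINT t:{0..}|lborel. mexp (t *\<^sub>R A) ** B ** transpose B ** mexp (t *\<^sub>R transpose A))"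

definition cosine_transform :: "real ^ 'd ^ 'd \<Rightarrow> real \<Rightarrow> real ^ 'd ^ 'd" where
  "cosine_transform A \<omega> = (1 / pi) *\<^sub>R (LINT t:{0..}|lborel. cos (\<omega> * t) *\<^sub>R mexp (t *\<^sub>R A))"

definition lambda2 ::
  "real ^ 'd ^ 'd \<Rightarrow> real ^ 'm ^ 'd \<Rightarrow> real ^ 'd \<Rightarrow> real ^ 'm \<Rightarrow> real \<Rightarrow> real" where
  "lambda2 A B a \<gamma> \<omega> = pi / \<omega>\<^sup>2 *
     (a \<bullet> (cosine_transform A \<omega> *v (stationary_cov A B *v a))
      + a \<bullet> (cosine_transform A \<omega> *v (B *v \<gamma>)) + (norm \<gamma>)\<^sup>2 / (2 * pi))"

section \<open>Two-sided Brownian motion and the Wiener integral\<close>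

definition brownian_motion :: "'w measure \<Rightarrow> (real \<Rightarrow> 'w \<Rightarrow> real ^ 'm) \<Rightarrow> bool" where
  "brownian_motion M W \<longleftrightarrow>
     prob_space M \<and>
     (\<forall>t. W t \<in> borel_measurable M) \<and>
     (AE x in M. W 0 x = 0) \<and>
     (AE x in M. continuous_on UNIV (\<lambda>t. W t x)) \<and>
     (\<forall>s t. s < t \<longrightarrow>
        (\<forall>j. distributed M lborel (\<lambda>x. (W t x - W s x) $ j) (normal_density 0 (sqrt (t - s)))) \<and>
        prob_space.indep_vars M (\<lambda>_. borel) (\<lambda>j x. (W t x - W s x) $ j) UNIV) \<and>
     (\<forall>(n::nat) p. (\<forall>i<n. p i < p (Suc i)) \<longrightarrow>
        prob_space.indep_vars M (\<lambda>_. borel) (\<lambda>i x. W (p (Suc i)) x - W (p i) x) {..<n})"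

text \<open>A list entry \<open>(C, l, u)\<close> with \<open>l \<le> u\<close> stands for the function \<open>1\<^bsub>(l,u]\<^esub> C\<close>.\<close>

definition step_fun ::
  "((real ^ 'm ^ 'n) \<times> real \<times> real) list \<Rightarrow> real \<Rightarrow> real ^ 'm ^ 'n" where
  "step_fun xs s = (\<Sum>(C, l, u)\<leftarrow>xs. indicator {l<..u} s *\<^sub>R C)"

definition step_integral ::
  "(real \<Rightarrow> 'w \<Rightarrow> real ^ 'm) \<Rightarrow> ((real ^ 'm ^ 'n) \<times> real \<times> real) list \<Rightarrow> 'w \<Rightarrow> real ^ 'n" where
  "step_integral W xs x = (\<Sum>(C, l, u)\<leftarrow>xs. C *v (W u x - W l x))"

text \<open>\<open>has_wiener_integral M W F X\<close>: the random vector \<open>X\<close> is a version of the integral of the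
  deterministic square-integrable matrix function \<open>F\<close> against \<open>W\<close>, i.e. an \<open>L\<^sup>2\<close>-limit of
  integrals of step functions converging to \<open>F\<close> in \<open>L\<^sup>2\<close>. The norm on matrices is the Frobenius
  norm. The relation determines \<open>X\<close> up to almost sure equality.\<close>

definition has_wiener_integral ::
  "'w measure \<Rightarrow> (real \<Rightarrow> 'w \<Rightarrow> real ^ 'm) \<Rightarrow> (real \<Rightarrow> real ^ 'm ^ 'n) \<Rightarrow> ('w \<Rightarrow> real ^ 'n) \<Rightarrow> bool"
where
  "has_wiener_integral M W F X \<longleftrightarrow>
     F \<in> borel_measurable lborel \<and> integrable lborel (\<lambda>s. (norm (F s))\<^sup>2) \<and>
     X \<in> borel_measurable M \<and> integrable M (\<lambda>x. (norm (X x))\<^sup>2) \<and>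
     (\<exists>f. (\<forall>n. \<forall>(C, l, u) \<in> set (f n). l \<le> u) \<and>
          (\<lambda>n::nat. LINT s|lborel. (norm (F s - step_fun (f n) s))\<^sup>2) \<longlonglongrightarrow> 0 \<and>
          (\<lambda>n. LINT x|M. (norm (X x - step_integral W (f n) x))\<^sup>2) \<longlonglongrightarrow> 0)"

text \<open>Solutions of \<open>dv = Av dt + B dW\<close> on the whole real line; the last clause,
  \<open>v(t) = \<integral>\<^bsub>-\<infinity>\<^esub>\<^bsup>t\<^esup> e\<^bsup>(t-s)A\<^esup>B dW(s)\<close>, singles out the stationary one. Continuity is
  required of every path, so that pathwise integrals of \<open>v\<close> are random variables even when \<open>M\<close>
  is not complete.\<close>

definition stationary_solution ::
  "'w measure \<Rightarrow> (real \<Rightarrow> 'w \<Rightarrow> real ^ 'm) \<Rightarrow> real ^ 'd ^ 'd \<Rightarrow> real ^ 'm ^ 'd \<Rightarrow>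
   (real \<Rightarrow> 'w \<Rightarrow> real ^ 'd) \<Rightarrow> bool"
where
  "stationary_solution M W A B v \<longleftrightarrow>
     (\<forall>x\<in>space M. continuous_on UNIV (\<lambda>t. v t x)) \<and>
     (AE x in M. \<forall>s t. s \<le> t \<longrightarrow>
        v t x = v s x + (LINT r:{s..t}|lborel. A *v v r x) + B *v (W t x - W s x)) \<and>
     (\<forall>t. has_wiener_integral M W
        (\<lambda>s. indicator {..t} s *\<^sub>R (mexp ((t - s) *\<^sub>R A) ** B)) (v t))"

section \<open>Mollification\<close>

definition piecewise_continuous :: "(real \<Rightarrow> real) \<Rightarrow> bool" where
  "piecewise_continuous f \<longleftrightarrow>
     (\<exists>S. finite S \<and> (\<forall>t. t \<notin> S \<longrightarrow> isCont f t) \<and>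
        (\<forall>t\<in>S. (\<exists>l. (f \<longlongrightarrow> l) (at_left t)) \<and> (\<exists>l. (f \<longlongrightarrow> l) (at_right t))))"

definition mollifier :: "(real \<Rightarrow> real) \<Rightarrow> bool" where
  "mollifier \<psi> \<longleftrightarrow> (\<forall>t. 0 \<le> \<psi> t) \<and> piecewise_continuous \<psi> \<and>
     (\<forall>t. t \<notin> {-1..1} \<longrightarrow> \<psi> t = 0) \<and> (LINT t|lborel. \<psi> t) = 1"

definition rescale :: "(real \<Rightarrow> real) \<Rightarrow> real \<Rightarrow> real \<Rightarrow> real" where
  "rescale \<psi> \<delta> t = (1 / \<delta>) * \<psi> (t / \<delta>)"

text \<open>\<open>\<xi> \<delta>\<close> is, for each \<open>\<delta> > 0\<close>, a version of the mollification of \<open>\<langle>a, v(t)\<rangle> + \<langle>\<gamma>, dW(t)/dt\<rangle>\<close>;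
  \<open>mat c\<close> is \<open>c\<close> times the identity matrix.\<close>

definition mollified_process ::
  "'w measure \<Rightarrow> (real \<Rightarrow> 'w \<Rightarrow> real ^ 'm) \<Rightarrow> (real \<Rightarrow> 'w \<Rightarrow> real ^ 'd) \<Rightarrow> real ^ 'd \<Rightarrow> real ^ 'm \<Rightarrow>
   (real \<Rightarrow> real) \<Rightarrow> (real \<Rightarrow> real \<Rightarrow> 'w \<Rightarrow> real) \<Rightarrow> bool"
where
  "mollified_process M W v a \<gamma> \<psi> \<xi> \<longleftrightarrow>
     (\<forall>\<delta>>0. \<forall>t. \<xi> \<delta> t \<in> borel_measurable M \<and>
        (\<exists>Z. has_wiener_integral M W (\<lambda>s. mat (rescale \<psi> \<delta> (t - s))) Z \<and>
           (AE x in M. \<xi> \<delta> t x =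
              (LINT s|lborel. (a \<bullet> v s x) * rescale \<psi> \<delta> (t - s)) + \<gamma> \<bullet> Z x)))"

section \<open>Power spectral density\<close>

definition autocov :: "'w measure \<Rightarrow> (real \<Rightarrow> 'w \<Rightarrow> real) \<Rightarrow> real \<Rightarrow> real" where
  "autocov M X t = (LINT x|M. X t x * X 0 x)"

definition L2_stationary_mean_zero :: "'w measure \<Rightarrow> (real \<Rightarrow> 'w \<Rightarrow> real) \<Rightarrow> bool" where
  "L2_stationary_mean_zero M X \<longleftrightarrow>
     (\<forall>t. X t \<in> borel_measurable M \<and> integrable M (\<lambda>x. (X t x)\<^sup>2) \<and> (LINT x|M. X t x) = 0) \<and>
     (\<forall>s t h. (LINT x|M. X (s + h) x * X (t + h) x) = (LINT x|M. X s x * X t x))"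

text \<open>The Bochner integral is \<open>0\<close> on non-integrable functions; \<open>psd\<close> is meaningful when
  \<open>psd_well_defined\<close> holds.\<close>

definition psd_well_defined :: "'w measure \<Rightarrow> (real \<Rightarrow> 'w \<Rightarrow> real) \<Rightarrow> bool" where
  "psd_well_defined M X \<longleftrightarrow> L2_stationary_mean_zero M X \<and> integrable lborel (autocov M X)"

definition psd :: "'w measure \<Rightarrow> (real \<Rightarrow> 'w \<Rightarrow> real) \<Rightarrow> real \<Rightarrow> complex" where
  "psd M X \<omega> = 1 / (2 * of_real pi) *
     (LINT t|lborel. of_real (autocov M X t) * exp (- \<i> * of_real \<omega> * of_real t))"

definition limit_psd :: "'w measure \<Rightarrow> (real \<Rightarrow> real \<Rightarrow> 'w \<Rightarrow> real) \<Rightarrow> real \<Rightarrow> complex" where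
  "limit_psd M \<xi> \<omega> = Lim (at_right 0) (\<lambda>\<delta>. psd M (\<xi> \<delta>) \<omega>)"

end

theory Submission
  imports Defs "HOL-Computational_Algebra.Fundamental_Theorem_Algebra"
begin

text \<open>Write \<open>p = \<psi>\<^sub>\<delta>\<close>, \<open>q(t) = p(-t)\<close>. The Wiener isometry gives \<open>E \<langle>a,v(s)\<rangle>\<langle>a,v(t)\<rangle> = K(s-t)\<close>
  with \<open>K(t) = \<langle>a, e\<^bsup>|t|A\<^esup>Ra\<rangle>\<close>, and the correlation of \<open>\<langle>a,v(s)\<rangle>\<close> with the noise at time \<open>t\<close> is the kernel
  \<open>h(s-t)\<close>, \<open>h(t) = 1\<^bsub>t\<ge>0\<^esub> \<langle>a, e\<^bsup>tA\<^esup>B\<gamma>\<rangle>\<close>. By Fubini the autocovariance of \<open>\<xi>\<^sub>\<delta>\<close> at lag \<open>t\<close> is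
  \<open>(p * q * K)(t) + (p * q * h)(t) + (p * q * h)(-t) + |\<gamma>|\<^sup>2 (p * q)(t)\<close>, an integrable function since
  \<open>e\<^bsup>tA\<^esup>\<close> decays exponentially. Its Fourier transform is that of \<open>K + h + h(-\<cdot>)\<close> plus \<open>|\<gamma>|\<^sup>2\<close>, times the
  product of the transforms of \<open>p\<close> at \<open>\<omega>\<close> and \<open>-\<omega>\<close>. That product tends to 1 with \<open>\<delta> \<rightarrow> 0\<close>,
  because the transform of \<open>p\<close> at \<open>\<omega>\<close> is that of \<open>\<psi>\<close> at \<open>\<delta>\<omega>\<close>.\<close>

text \<open>White noise has no pointwise values; its covariance would be a point mass. For positive
  \<delta> this mass is the function \<open>p * q\<close> weighted by |\<gamma>|^2, so every term is
  an L1 convolution, and the limit is taken only on the transform side, where \<delta> and \<psi>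
  enter through one scalar factor. The cosine transform is a one-sided integral, the spectral
  density a two-sided one. The bridge is a half-line kernel together with its reflection: their
  transforms add up to 2\<pi> times a cosine transform, and \<open>psd\<close> divides by 2\<pi>. K
  is of this shape with vector Ra, the pair h, h(-.) with vector B\<gamma>, so one computation
  serves both. The Wiener integral is known only as an L2 limit of step integrals. The isometry is
  therefore proved for steps and extended by continuity, and it is stated for pairings with fixed
  vectors, because integrals with values in different spaces (v in dimension d, noise in dimension
  m) have to be correlated. The decay must come from the position of the eigenvalues alone; it is
  proved for one vector at a time, which needs only a polynomial annihilating that vector.\<close>

section \<open>Matrix operations as bounded linear and bilinear maps\<close>

text \<open>Finite dimension turns bilinearity into boundedness. The packaged form later yields the
  product rule, continuity, termwise action on series and a constant K bounding the norm of a
  product.\<close>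

lemma bounded_bilinear_matrix_mult:
  "bounded_bilinear ((**) :: real ^ 'b ^ 'a \<Rightarrow> real ^ 'c ^ 'b \<Rightarrow> real ^ 'c ^ 'a)"
  unfolding bilinear_conv_bounded_bilinear[symmetric] bilinear_def
  by (auto intro!: linearI simp: vec_eq_iff matrix_matrix_mult_def sum.distrib algebra_simps
      sum_distrib_left)

lemma matrix_mult_scaleR [simp]:
  fixes A :: "real ^ 'b ^ 'a" and B :: "real ^ 'c ^ 'b"
  shows "(k *\<^sub>R A) ** B = k *\<^sub>R (A ** B)" "A ** (k *\<^sub>R B) = k *\<^sub>R (A ** B)"
  using bounded_bilinear.scaleR_left[OF bounded_bilinear_matrix_mult]
    bounded_bilinear.scaleR_right[OF bounded_bilinear_matrix_mult] by blast+

lemma bounded_bilinear_complex_matrix_vector: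
  "bounded_bilinear ((*v) :: complex ^ 'b ^ 'a \<Rightarrow> complex ^ 'b \<Rightarrow> complex ^ 'a)"
  unfolding bilinear_conv_bounded_bilinear[symmetric] bilinear_def
  apply (auto intro!: linearI simp: matrix_vector_mult_add_rdistrib matrix_vector_right_distrib)
   apply (simp_all add: vec_eq_iff matrix_vector_mult_def scaleR_sum_right)
  done

lemma bounded_bilinear_matrix_vector:
  "bounded_bilinear ((*v) :: real ^ 'b ^ 'a \<Rightarrow> real ^ 'b \<Rightarrow> real ^ 'a)"
  unfolding bilinear_conv_bounded_bilinear[symmetric] bilinear_def
  apply (auto intro!: linearI simp: matrix_vector_mult_add_rdistrib matrix_vector_right_distrib matrix_vector_mult_scaleR scaleR_matrix_vector_assoc)
  done

lemma bounded_bilinear_complex_scale: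
  "bounded_bilinear ((*s) :: complex \<Rightarrow> complex ^ 'b \<Rightarrow> complex ^ 'b)"
  unfolding bilinear_conv_bounded_bilinear[symmetric] bilinear_def
  by (auto intro!: linearI simp: vec_eq_iff algebra_simps)

lemma norm_complex_scale: "norm (z *s x) = norm z * norm (x :: complex ^ 'b)"
  by (simp add: norm_vec_def norm_mult L2_set_right_distrib)

lemma bounded_linear_transpose: "bounded_linear (transpose :: real ^ 'b ^ 'a \<Rightarrow> real ^ 'a ^ 'b)"
  unfolding linear_conv_bounded_linear[symmetric]
  by (auto intro!: linearI simp: vec_eq_iff transpose_def)

lemma bounded_linear_complex_matrix:
  "bounded_linear (map_matrix complex_of_real :: real ^ 'b ^ 'a \<Rightarrow> complex ^ 'b ^ 'a)"
  unfolding linear_conv_bounded_linear[symmetric]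
  by (auto intro!: linearI simp: vec_eq_iff map_matrix_def scaleR_conv_of_real[where 'a=complex])

lemma complex_matrix_mult:
  "map_matrix complex_of_real (A ** B) = map_matrix complex_of_real A ** map_matrix complex_of_real B"
  by (simp add: vec_eq_iff map_matrix_def matrix_matrix_mult_def)

lemma complex_matrix_one: "map_matrix complex_of_real (mat 1) = mat 1"
  by (simp add: vec_eq_iff map_matrix_def mat_def)


section \<open>The matrix exponential\<close>

lemma matpow_0 [simp]: "matpow A 0 = mat 1"
  by (simp add: matpow_def)

lemma matpow_Suc: "matpow A (Suc k) = A ** matpow A k"
  by (simp add: matpow_def)

lemma matpow_Suc_right: "matpow A (Suc k) = matpow A k ** A"
  by (induction k) (simp_all add: matpow_Suc matrix_mul_assoc)

lemma matpow_scaleR: "matpow (t *\<^sub>R A) k = t ^ k *\<^sub>R matpow A k"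
  by (induction k) (simp_all add: matpow_Suc mult.commute)

lemma matpow_transpose: "matpow (transpose A) k = transpose (matpow A k)"
proof (induction k)
  case (Suc k)
  then show ?case by (subst matpow_Suc_right) (simp add: matpow_Suc matrix_transpose_mul)
qed simp

text \<open>By induction \<open>norm (matpow A k)\<close> is at most the norm of the identity times
  \<open>(norm A * K) ^ k\<close>, and an exponential series dominates. The norm of the identity
  stays as a factor because the norm is the Frobenius norm.\<close>

lemma summable_mexp:
  fixes A :: "real ^ 'n ^ 'n"
  shows "summable (\<lambda>k. norm ((1 / fact k) *\<^sub>R matpow A k))"
proof -
  obtain K where K: "K > 0" "\<And>(X :: real ^ 'n ^ 'n) (Y :: real ^ 'n ^ 'n). norm (X ** Y) \<le> norm X * norm Y * K"
    using bounded_bilinear.pos_bounded[OF bounded_bilinear_matrix_mult] by blast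
  have b: "norm (matpow A k) \<le> norm (mat 1 :: real ^ 'n ^ 'n) * (norm A * K) ^ k" for k
  proof (induction k)
    case (Suc k)
    have "norm (matpow A (Suc k)) \<le> norm A * norm (matpow A k) * K"
      unfolding matpow_Suc by (rule K)
    also have "\<dots> \<le> norm A * (norm (mat 1 :: real ^ 'n ^ 'n) * (norm A * K) ^ k) * K"
      using Suc K by (intro mult_right_mono mult_left_mono) auto
    finally show ?case by (simp add: algebra_simps)
  qed simp
  have "summable (\<lambda>k. norm (mat 1 :: real ^ 'n ^ 'n) * (inverse (fact k) * (norm A * K) ^ k))"
    by (intro summable_mult summable_exp)
  moreover have "norm (norm ((1 / fact k) *\<^sub>R matpow A k))
      \<le> norm (mat 1 :: real ^ 'n ^ 'n) * (inverse (fact k) * (norm A * K) ^ k)" for k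
  proof -
    have "norm (norm ((1 / fact k) *\<^sub>R matpow A k)) = inverse (fact k) * norm (matpow A k)"
      by (simp add: divide_inverse)
    also have "\<dots> \<le> inverse (fact k) * (norm (mat 1 :: real ^ 'n ^ 'n) * (norm A * K) ^ k)"
      by (intro mult_left_mono b) simp
    also have "\<dots> = norm (mat 1 :: real ^ 'n ^ 'n) * (inverse (fact k) * (norm A * K) ^ k)"
      by (rule mult.left_commute)
    finally show ?thesis .
  qed
  ultimately show ?thesis
    by (rule summable_comparison_test'[where N = 0])
qed

lemma mexp_sums: "(\<lambda>k. (1 / fact k) *\<^sub>R matpow A k) sums mexp A"
  unfolding mexp_def by (intro summable_sums summable_norm_cancel[OF summable_mexp])

lemma mexp_scaleR_sums: "(\<lambda>k. (t ^ k / fact k) *\<^sub>R matpow A k) sums mexp (t *\<^sub>R A)"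
  using mexp_sums[of "t *\<^sub>R A"] by (simp add: matpow_scaleR)

lemma mexp_0 [simp]: "mexp 0 = mat 1"
proof -
  have "(\<lambda>k. (0 ^ k / fact k) *\<^sub>R matpow (0 :: real ^ 'a ^ 'a) k) sums ((0 ^ 0 / fact 0) *\<^sub>R matpow 0 0)"
    using sums_finite[of "{0}" "\<lambda>k. (0 ^ k / fact k) *\<^sub>R matpow (0 :: real ^ 'a ^ 'a) k"]
    by simp
  with mexp_scaleR_sums[of 0 "0 :: real ^ 'a ^ 'a"] show ?thesis
    by (auto dest: sums_unique2)
qed

lemma mexp_transpose: "mexp (transpose A) = transpose (mexp A)"
proof -
  from bounded_linear.sums[OF bounded_linear_transpose mexp_sums[of A]] mexp_sums[of "transpose A"] show ?thesis
    unfolding matpow_transpose transpose_scalar[symmetric] by (rule sums_unique2[symmetric])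
qed

text \<open>Both products are the series of \<open>matpow A (Suc k)\<close> with the same
  coefficients, as A may be attached on either side of a power.\<close>

lemma mexp_commute: "A ** mexp (t *\<^sub>R A) = mexp (t *\<^sub>R A) ** A"
proof -
  have "(\<lambda>k. A ** ((t ^ k / fact k) *\<^sub>R matpow A k)) sums (A ** mexp (t *\<^sub>R A))"
    by (rule bounded_linear.sums[OF bounded_bilinear.bounded_linear_right[OF
          bounded_bilinear_matrix_mult] mexp_scaleR_sums])
  moreover have "(\<lambda>k. ((t ^ k / fact k) *\<^sub>R matpow A k) ** A) sums (mexp (t *\<^sub>R A) ** A)"
    by (rule bounded_linear.sums[OF bounded_bilinear.bounded_linear_left[OF
          bounded_bilinear_matrix_mult] mexp_scaleR_sums])
  ultimately show ?thesis
    unfolding matrix_mult_scaleR matpow_Suc[symmetric] matpow_Suc_right[symmetric]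
    by (rule sums_unique2)
qed

text \<open>Each entry is a scalar power series in t that converges everywhere, so it may be
  differentiated termwise; the entries are the coordinates in the standard basis of the matrix
  space.\<close>

lemma has_vector_derivative_mexp:
  "((\<lambda>t. mexp (t *\<^sub>R A)) has_vector_derivative A ** mexp (t *\<^sub>R A)) (at t within S)"
proof -
  have ij: "((\<lambda>t. mexp (t *\<^sub>R A) $ i $ j) has_field_derivative (A ** mexp (t *\<^sub>R A)) $ i $ j) (at t)" for i j t
  proof -
    have bl: "bounded_linear (\<lambda>X :: real ^ 'a ^ 'a. X $ i $ j)"
      by (intro bounded_linear_compose[OF bounded_linear_vec_nth bounded_linear_vec_nth, unfolded o_def])
    define c where "c k = matpow A k $ i $ j / fact k" for k
    have s: "(\<lambda>k. c k * t ^ k) sums (mexp (t *\<^sub>R A) $ i $ j)" for t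
      using bounded_linear.sums[OF bl mexp_scaleR_sums[of t A]] by (simp add: c_def field_simps)
    then have e: "mexp (t *\<^sub>R A) $ i $ j = (\<Sum>k. c k * t ^ k)" for t
      by (simp add: sums_iff)
    \<comment> \<open>\<open>diffs\<close> shifts the index and multiplies by \<open>Suc k\<close>,
      which turns \<open>fact (Suc k)\<close> into \<open>fact k\<close>.\<close>
    have "diffs c k = matpow A (Suc k) $ i $ j / fact k" for k
      by (simp add: c_def diffs_def field_simps del: of_nat_Suc)
    moreover have "(\<lambda>k. (matpow A (Suc k) $ i $ j / fact k) * t ^ k) sums (A ** mexp (t *\<^sub>R A)) $ i $ j"
      using bounded_linear.sums[OF bl bounded_linear.sums[OF
         bounded_bilinear.bounded_linear_right[OF bounded_bilinear_matrix_mult] mexp_scaleR_sums[of t A]], of A]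
      by (simp add: matpow_Suc field_simps)
    ultimately have d: "(\<Sum>k. diffs c k * t ^ k) = (A ** mexp (t *\<^sub>R A)) $ i $ j"
      by (simp add: sums_iff)
    have "((\<lambda>t. \<Sum>k. c k * t ^ k) has_field_derivative (\<Sum>k. diffs c k * t ^ k)) (at t)"
      by (rule termdiffs_strong_converges_everywhere) (use s in \<open>auto simp: sums_iff\<close>)
    then show ?thesis by (simp only: e d)
  qed
  show ?thesis
    unfolding has_vector_derivative_def
  proof (rule has_derivative_componentwise_within[THEN iffD2], rule ballI)
    fix b :: "real ^ 'a ^ 'a" assume "b \<in> Basis"
    then obtain i j where "b = axis i (axis j 1)"
      by (auto simp: Basis_vec_def)
    then have b: "X \<bullet> b = X $ i $ j" for X
      by (simp add: inner_axis)
    show "((\<lambda>t. mexp (t *\<^sub>R A) \<bullet> b) has_derivative (\<lambda>h. (h *\<^sub>R (A ** mexp (t *\<^sub>R A))) \<bullet> b)) (at t within S)"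
      using has_field_derivative_at_within[OF ij[of i j t], of S]
      unfolding b has_field_derivative_def by (simp add: mult_commute_abs)
  qed
qed

lemma continuous_mexp: "continuous_on UNIV (\<lambda>t. mexp (t *\<^sub>R A))"
  by (rule continuous_on_vector_derivative) (rule has_vector_derivative_mexp)

text \<open>The product of \<open>mexp (- t *\<^sub>R A)\<close> and
  \<open>mexp ((t + s) *\<^sub>R A)\<close> has derivative zero in t, hence keeps its value
  \<open>mexp (s *\<^sub>R A)\<close> at t = 0. The case s = 0 gives inverses, which then move the
  first factor to the other side.\<close>

lemma mexp_add: "mexp ((s + t) *\<^sub>R A) = mexp (s *\<^sub>R A) ** mexp (t *\<^sub>R A)"
proof -
  have d: "((\<lambda>t. mexp (- t *\<^sub>R A)) has_vector_derivative - (A ** mexp (- t *\<^sub>R A))) (at t)" for t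
  proof -
    have "(uminus has_vector_derivative - 1) (at t)"
      unfolding has_real_derivative_iff_has_vector_derivative[symmetric]
      by (auto intro!: derivative_eq_intros)
    from vector_diff_chain_at[OF this has_vector_derivative_mexp] show ?thesis by (simp add: o_def)
  qed
  have d': "((\<lambda>t. mexp ((t + s) *\<^sub>R A)) has_vector_derivative A ** mexp ((t + s) *\<^sub>R A)) (at t)" for s t
  proof -
    have "((\<lambda>t. t + s) has_vector_derivative 1) (at t)"
      unfolding has_real_derivative_iff_has_vector_derivative[symmetric]
      by (auto intro!: derivative_eq_intros)
    from vector_diff_chain_at[OF this has_vector_derivative_mexp] show ?thesis by (simp add: o_def)
  qed
  have z: "((\<lambda>t. mexp (- t *\<^sub>R A) ** mexp ((t + s) *\<^sub>R A)) has_derivative (\<lambda>h. 0)) (at t)" for s t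
  proof -
    have "mexp (- t *\<^sub>R A) ** (A ** mexp ((t + s) *\<^sub>R A)) =
        A ** mexp (- t *\<^sub>R A) ** mexp ((t + s) *\<^sub>R A)"
      by (metis mexp_commute matrix_mul_assoc)
    then show ?thesis
      using bounded_bilinear.has_vector_derivative[OF bounded_bilinear_matrix_mult d[of t] d'[of s t]]
      by (simp add: has_vector_derivative_def bounded_bilinear.minus_left[OF bounded_bilinear_matrix_mult])
  qed
  have c: "mexp (- t *\<^sub>R A) ** mexp ((t + s) *\<^sub>R A) = mexp (s *\<^sub>R A)" for s t
    using has_derivative_zero_unique[OF convex_UNIV z[of s], of t 0] by simp
  have inv: "mexp (t *\<^sub>R A) ** mexp (- t *\<^sub>R A) = mat 1" for t
    using c[of "-t" 0] by simp
  have "mexp (s *\<^sub>R A) ** (mexp (- s *\<^sub>R A) ** mexp ((s + t) *\<^sub>R A)) = mexp ((s + t) *\<^sub>R A)"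
    using inv[of s] by (simp add: matrix_mul_assoc)
  then show ?thesis unfolding c by simp
qed

section \<open>Exponential decay\<close>

text \<open>The vector p(A)x by Horner's scheme; no power of the complex matrix has to be
  formed.\<close>

definition poly_app :: "complex ^ 'n ^ 'n \<Rightarrow> complex poly \<Rightarrow> complex ^ 'n \<Rightarrow> complex ^ 'n" where
  "poly_app A p x = fold_coeffs (\<lambda>c y. c *s x + A *v y) p 0"

lemma poly_app_0 [simp]: "poly_app A 0 x = 0"
  by (simp add: poly_app_def)

lemma poly_app_pCons [simp]: "poly_app A (pCons c p) x = c *s x + A *v poly_app A p x"
  by (cases "c = 0 \<and> p = 0") (auto simp: poly_app_def)

lemma poly_app_add: "poly_app A (p + q) x = poly_app A p x + poly_app A q x"
  by (induction p q rule: poly_induct2) (auto simp: vec.add algebra_simps vector_sadd_rdistrib matrix_vector_right_distrib)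

lemma poly_app_smult: "poly_app A (smult c p) x = c *s poly_app A p x"
  by (induction p) (auto simp: vector_add_ldistrib vector_scalar_commute vector_smult_assoc)

text \<open>Polynomials in A commute with \<open>A - z\<close>. Once a root z is split off, this
  hands the quotient polynomial on to \<open>A x - z x\<close>.\<close>

lemma poly_app_vec: "poly_app A p (A *v x - z *s x) = A *v poly_app A p x - z *s poly_app A p x"
  by (induction p) (auto simp: vector_ssub_ldistrib vector_scalar_commute vector_smult_assoc
      matrix_vector_right_distrib matrix_vector_mult_diff_distrib vector_add_ldistrib mult.commute)

lemma poly_app_linear_factor: "poly_app A ([:- z, 1:] * p) x = A *v poly_app A p x - z *s poly_app A p x"
  by (simp add: poly_app_add poly_app_smult del: smult_minus_left)

lemma poly_app_monom: "poly_app A (monom 1 k) x = ((*v) A ^^ k) x"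
  by (induction k) (simp_all add: monom_0 monom_Suc)

text \<open>Among the iterates x, Ax, AAx, ... one lies in the span of its predecessors, since
  otherwise there would be more independent vectors than the dimension allows. This linear relation,
  read as a polynomial, annihilates x.\<close>

lemma ex_annihilating_poly:
  fixes A :: "complex ^ 'n ^ 'n"
  shows "\<exists>p. p \<noteq> 0 \<and> poly_app A p x = 0"
proof -
  let ?u = "\<lambda>i. ((*v) A ^^ i) x"
  have "\<exists>k. ?u k \<in> vec.span (?u ` {..<k})"
  proof (rule ccontr)
    assume "\<not> ?thesis"
    then have n: "?u k \<notin> vec.span (?u ` {..<k})" for k by (rule contrapos_nn) (rule exI)
    \<comment> \<open>The cardinality is carried along because an image could collapse; a vector
      outside the span of the earlier ones is in particular a new one.\<close>
    have "vec.independent (?u ` {..<k}) \<and> card (?u ` {..<k}) = k" for k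
    proof (induction k)
      case (Suc k)
      have nk: "?u k \<notin> ?u ` {..<k}" using n[of k] by (rule contrapos_nn) (rule vec.span_base)
      have "vec.independent (insert (?u k) (?u ` {..<k}))"
        using n[of k] conjunct1[OF Suc] by (rule vec.independent_insertI)
      moreover have "card (insert (?u k) (?u ` {..<k})) = Suc k"
        using conjunct2[OF Suc] nk by (subst card_insert_disjoint) simp_all
      ultimately show ?case unfolding lessThan_Suc image_insert by (rule conjI)
    qed (simp add: vec.independent_empty)
    from this[of "Suc CARD('n)"] have
      i: "vec.independent (?u ` {..<Suc CARD('n)})" and c: "card (?u ` {..<Suc CARD('n)}) = Suc CARD('n)"
      by (rule conjunct1, rule conjunct2)
    from vec.independent_card_le_dim[OF subset_refl i] dim_subset_UNIV_cart_gen[of "?u ` {..<Suc CARD('n)}"]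
    show False unfolding c by linarith
  qed
  then obtain k where k: "?u k \<in> vec.span (?u ` {..<k})" ..
  \<comment> \<open>Vectors reachable by polynomials of degree below k. P is a subspace containing
    the earlier iterates, so it contains their span.\<close>
  define P where "P = {poly_app A p x | p. \<forall>i\<ge>k. coeff p i = 0}"
  have "vec.subspace P"
    unfolding vec.subspace_def P_def
  proof (intro conjI ballI allI)
    show "0 \<in> {poly_app A p x |p. \<forall>i\<ge>k. coeff p i = 0}"
      by (auto intro!: exI[of _ 0])
  next
    fix u v assume "u \<in> {poly_app A p x |p. \<forall>i\<ge>k. coeff p i = 0}" "v \<in> {poly_app A p x |p. \<forall>i\<ge>k. coeff p i = 0}"
    then obtain p q where "u = poly_app A p x" "v = poly_app A q x" "\<forall>i\<ge>k. coeff p i = 0" "\<forall>i\<ge>k. coeff q i = 0"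
      by auto
    then show "u + v \<in> {poly_app A p x |p. \<forall>i\<ge>k. coeff p i = 0}"
      by (auto intro!: exI[of _ "p + q"] simp: poly_app_add)
  next
    fix u c assume "u \<in> {poly_app A p x |p. \<forall>i\<ge>k. coeff p i = 0}"
    then obtain p where "u = poly_app A p x" "\<forall>i\<ge>k. coeff p i = 0"
      by auto
    then show "c *s u \<in> {poly_app A p x |p. \<forall>i\<ge>k. coeff p i = 0}"
      by (auto intro!: exI[of _ "smult c p"] simp: poly_app_smult)
  qed
  moreover have "?u ` {..<k} \<subseteq> P"
    by (auto simp: P_def poly_app_monom[symmetric] intro!: exI)
  ultimately have "?u k \<in> P"
    using k vec.span_minimal by blast
  then obtain p where p: "?u k = poly_app A p x" "\<forall>i\<ge>k. coeff p i = 0"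
    by (auto simp: P_def)
  have "poly_app A (monom 1 k + smult (- 1) p) x = 0"
    by (simp add: poly_app_add poly_app_smult poly_app_monom p del: smult_minus_left)
  \<comment> \<open>The monomial contributes 1 at index k and p contributes 0, which shows that the
    polynomial is nonzero.\<close>
  moreover have "coeff (monom 1 k + smult (- 1) p) k = 1"
    using p by simp
  ultimately show ?thesis
    by (metis coeff_0 zero_neq_one)
qed

text \<open>Induction on the degree of the annihilating polynomial: split off a root \<open>z\<close>. If \<open>z\<close> is not an
  eigenvalue, the quotient still annihilates \<open>x\<close>. Otherwise \<open>u(t) = e\<^bsup>tA\<^esup>x\<close> solves \<open>u' = zu + e\<^bsup>tA\<^esup>y\<close>,
  where \<open>y = Ax - zx\<close> is annihilated by the quotient.\<close>

lemma stable_matrix_decay_vec: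
  fixes A :: "real ^ 'n ^ 'n"
  assumes st: "stable_matrix A" and "p \<noteq> 0" "poly_app (map_matrix complex_of_real A) p x = 0"
  shows "\<exists>C c. c > 0 \<and> C \<ge> 0 \<and>
     (\<forall>t\<ge>0. norm (map_matrix complex_of_real (mexp (t *\<^sub>R A)) *v x) \<le> C * exp (- c * t))"
  using assms(2,3)
proof (induction "degree p" arbitrary: p x)
  case 0
  then obtain c where "p = [:c:]" "c \<noteq> 0"
    by (metis degree_eq_zeroE pCons_0_0)
  with 0 have "x = 0" by (auto simp: vec_eq_iff)
  then show ?case by (intro exI[of _ "0::real"] exI[of _ "1::real"]) simp
next
  case (Suc n)
  let ?c = "map_matrix complex_of_real"
  let ?u = "\<lambda>t. ?c (mexp (t *\<^sub>R A)) *v x"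
  obtain z where "poly p z = 0"
    using fundamental_theorem_of_algebra_alt[of p] Suc(2) by (metis degree_pCons_0 nat.distinct(1))
  then obtain q where q: "p = [:- z, 1:] * q" by (auto simp: poly_eq_0_iff_dvd)
  with Suc have "q \<noteq> 0" by auto
  then have deg: "n = degree q"
    using Suc(2) unfolding q by (subst (asm) degree_mult_eq) auto
  let ?y = "?c A *v x - z *s x"
  have qz: "?c A *v poly_app (?c A) q x - z *s poly_app (?c A) q x = 0"
    using Suc(4) unfolding q poly_app_linear_factor .
  show ?case
  proof (cases "complex_eigenvalue A z")
    case False
    \<comment> \<open>The quotient applied to x is killed by \<open>A - z\<close>; as z is no
      eigenvalue, it vanishes.\<close>
    then have "poly_app (?c A) q x = 0"
      using qz by (auto simp: complex_eigenvalue_def)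
    then show ?thesis using Suc(1)[OF deg \<open>q \<noteq> 0\<close>] by blast
  next
    case True
    then have rez: "Re z < 0" using st by (auto simp: stable_matrix_def)
    have "poly_app (?c A) q ?y = 0" using qz by (simp add: poly_app_vec)
    from Suc(1)[OF deg \<open>q \<noteq> 0\<close> this] obtain C c where c: "c > 0" "C \<ge> 0"
      and w: "\<And>t. t \<ge> 0 \<Longrightarrow> norm (?c (mexp (t *\<^sub>R A)) *v ?y) \<le> C * exp (- c * t)" by auto
    \<comment> \<open>The new rate has to lie strictly below \<open>- Re z\<close>, so that \<mu> is
      positive. If c met \<open>- Re z\<close> exactly, the integrated forcing would grow like t;
      halving \<open>- Re z\<close> avoids this resonance.\<close>
    define c' where "c' = min c (- Re z / 2)"
    define \<mu> where "\<mu> = - Re z - c'"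
    have c': "c' > 0" "c' \<le> c" "\<mu> > 0" "Re z \<le> - c'"
      using c rez by (auto simp: c'_def \<mu>_def min_def)
    \<comment> \<open>Integrating factor: it removes the term zu from the equation, so the
      derivative of \<open>?f\<close> is the forcing alone.\<close>
    let ?f = "\<lambda>t. exp (- z * of_real t) *s ?u t"
    have du: "(?u has_vector_derivative ?c (mexp (t *\<^sub>R A)) *v ?y + z *s ?u t) (at t)" for t
    proof -
      have "((\<lambda>t. ?c (mexp (t *\<^sub>R A))) has_vector_derivative ?c (A ** mexp (t *\<^sub>R A))) (at t)"
        by (rule bounded_linear.has_vector_derivative[OF bounded_linear_complex_matrix has_vector_derivative_mexp])
      from bounded_linear.has_vector_derivative[OF
          bounded_bilinear.bounded_linear_left[OF bounded_bilinear_complex_matrix_vector] this, of x]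
      have "(?u has_vector_derivative ?c (A ** mexp (t *\<^sub>R A)) *v x) (at t)" .
      also have "?c (A ** mexp (t *\<^sub>R A)) *v x = ?c (mexp (t *\<^sub>R A)) *v (?c A *v x)"
        unfolding mexp_commute by (simp add: complex_matrix_mult matrix_vector_mul_assoc)
      also have "\<dots> = ?c (mexp (t *\<^sub>R A)) *v ?y + z *s ?u t"
        by (simp add: matrix_vector_mult_diff_distrib vector_scalar_commute)
      finally show ?thesis .
    qed
    have df: "(?f has_vector_derivative exp (- z * of_real t) *s (?c (mexp (t *\<^sub>R A)) *v ?y)) (at t)" for t
    proof -
      have "((\<lambda>t. exp (- z * of_real t)) has_vector_derivative (- z * exp (- z * of_real t))) (at t)"
        by (rule has_vector_derivative_real_field) (auto intro!: derivative_eq_intros)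
      from bounded_bilinear.has_vector_derivative[OF bounded_bilinear_complex_scale this du[of t]]
      show ?thesis
        by (simp add: vector_add_ldistrib vector_smult_assoc mult.commute)
    qed
    have "norm (?u t) \<le> (norm x + C / \<mu>) * exp (- c' * t)" if t: "t \<ge> 0" for t
    proof -
      \<comment> \<open>Mean value inequality. The derivative of the majorant dominates the forcing
        because \<open>c' \<le> c\<close>. The case t = 0 is split off since the inequality is
        applied on a proper interval.\<close>
      have "norm (?f t - ?f 0) \<le> C / \<mu> * exp (\<mu> * t) - C / \<mu> * exp (\<mu> * 0)"
      proof (cases "t = 0")
        case False
        show ?thesis
        proof (rule differentiable_bound_general[where f = ?f and \<phi> = "\<lambda>t. C / \<mu> * exp (\<mu> * t)"
              and f' = "\<lambda>t. exp (- z * of_real t) *s (?c (mexp (t *\<^sub>R A)) *v ?y)"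
              and \<phi>' = "\<lambda>t. C * exp (\<mu> * t)"])
          show "0 < t" using False t by simp
          show "continuous_on {0..t} ?f"
            by (rule continuous_on_vector_derivative) (rule has_vector_derivative_at_within[OF df])
          show "continuous_on {0..t} (\<lambda>t. C / \<mu> * exp (\<mu> * t))"
            by (intro continuous_intros)
          show "((\<lambda>t. C / \<mu> * exp (\<mu> * t)) has_vector_derivative C * exp (\<mu> * s)) (at s)" for s
            using c' unfolding has_real_derivative_iff_has_vector_derivative[symmetric]
            by (auto intro!: derivative_eq_intros)
          fix s :: real assume s: "0 < s"
          have "norm (exp (- z * of_real s) *s (?c (mexp (s *\<^sub>R A)) *v ?y))
              \<le> exp (- Re z * s) * (C * exp (- c * s))"
            unfolding norm_complex_scale by (intro mult_mono w) (use s in auto)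
          also have "\<dots> = C * exp ((- Re z - c) * s)"
            by (simp only: mult.left_commute[of _ C] mult_exp_exp) (simp add: algebra_simps)
          also have "\<dots> \<le> C * exp (\<mu> * s)"
            using c c' s by (intro mult_left_mono) (auto simp: \<mu>_def)
          finally show "norm (exp (- z * of_real s) *s (?c (mexp (s *\<^sub>R A)) *v ?y)) \<le> C * exp (\<mu> * s)" .
        qed (rule df)
      qed simp
      also have "\<dots> \<le> C / \<mu> * exp (\<mu> * t)" using c c' by simp
      finally have "norm (?f t) \<le> norm x + C / \<mu> * exp (\<mu> * t)"
        using norm_triangle_sub[of "?f t" "?f 0"] by (simp add: complex_matrix_one)
      \<comment> \<open>Undoing the integrating factor; \<open>\<mu> + Re z = - c'\<close> turns the
        majorant into the desired decay.\<close>
      then have "exp (Re z * t) * norm (?f t) \<le> exp (Re z * t) * (norm x + C / \<mu> * exp (\<mu> * t))"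
        by (intro mult_left_mono) auto
      also have "exp (Re z * t) * norm (?f t) = norm (?u t)"
        by (simp add: norm_complex_scale mult_exp_exp)
      also have "exp (Re z * t) * (norm x + C / \<mu> * exp (\<mu> * t))
          = norm x * exp (Re z * t) + C / \<mu> * exp (- c' * t)"
        by (simp add: algebra_simps mult_exp_exp \<mu>_def)
      also have "\<dots> \<le> norm x * exp (- c' * t) + C / \<mu> * exp (- c' * t)"
        using mult_left_mono[of "exp (Re z * t)" "exp (- c' * t)" "norm x"] mult_right_mono[OF c'(4) t] by simp
      finally show ?thesis by (simp add: algebra_simps)
    qed
    then show ?thesis
      using c c' by (intro exI[of _ "norm x + C / \<mu>"] exI[of _ c']) auto
  qed
qed

text \<open>Column j of the exponential is its action on the j-th unit vector, to which the bound
  for vectors applies. The finitely many rates are replaced by their minimum, and the norm is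
  bounded by the sum of the absolute entries.\<close>

lemma stable_matrix_decay:
  fixes A :: "real ^ 'n ^ 'n"
  assumes "stable_matrix A"
  obtains C c where "c > 0" "C \<ge> 0" "\<And>t. t \<ge> 0 \<Longrightarrow> norm (mexp (t *\<^sub>R A)) \<le> C * exp (- c * t)"
proof -
  let ?c = "map_matrix complex_of_real"
  have ex: "\<exists>C c. c > 0 \<and> C \<ge> 0 \<and>
     (\<forall>t\<ge>0. norm (?c (mexp (t *\<^sub>R A)) *v axis j 1) \<le> C * exp (- c * t))" for j :: 'n
  proof -
    obtain p where "p \<noteq> 0" "poly_app (?c A) p (axis j 1) = 0"
      using ex_annihilating_poly by blast
    then show ?thesis by (rule stable_matrix_decay_vec[OF assms])
  qed
  obtain C where "\<forall>j. \<exists>c. c > 0 \<and> C j \<ge> 0 \<and>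
     (\<forall>t\<ge>0. norm (?c (mexp (t *\<^sub>R A)) *v axis j 1) \<le> C j * exp (- c * t))"
    using choice[OF allI[OF ex]] by (rule exE)
  from choice[OF this] obtain c where Cc: "\<forall>j. c j > 0 \<and> C j \<ge> 0 \<and>
     (\<forall>t\<ge>0. norm (?c (mexp (t *\<^sub>R A)) *v axis j 1) \<le> C j * exp (- c j * t))" by (rule exE)
  then have c: "\<And>j. c j > 0" "\<And>j. C j \<ge> 0"
    and b: "\<And>j t. t \<ge> 0 \<Longrightarrow> norm (?c (mexp (t *\<^sub>R A)) *v axis j 1) \<le> C j * exp (- c j * t)"
    by auto
  define m where "m = Min (range c)"
  have m: "m > 0" "m \<le> c j" for j
    using c by (auto simp: m_def)
  have "norm (mexp (t *\<^sub>R A)) \<le> (\<Sum>i\<in>(UNIV :: 'n set). \<Sum>j\<in>UNIV. C j) * exp (- m * t)" if t: "t \<ge> 0" for t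
  proof -
    have e: "\<bar>mexp (t *\<^sub>R A) $ i $ j\<bar> \<le> C j * exp (- m * t)" for i j
    proof -
      have "(?c (mexp (t *\<^sub>R A)) *v axis j 1) $ i = complex_of_real (mexp (t *\<^sub>R A) $ i $ j)"
        by (simp add: matrix_vector_mult_def map_matrix_def axis_def if_distrib[where f="\<lambda>x. _ * x"] cong: if_cong)
      then have "\<bar>mexp (t *\<^sub>R A) $ i $ j\<bar> \<le> norm (?c (mexp (t *\<^sub>R A)) *v axis j 1)"
        by (metis component_le_norm_cart Finite_Cartesian_Product.norm_nth_le norm_of_real)
      also have "\<dots> \<le> C j * exp (- c j * t)" by (rule b[OF t])
      also have "\<dots> \<le> C j * exp (- m * t)"
        using c m t by (intro mult_left_mono) (auto intro: mult_right_mono)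
      finally show ?thesis .
    qed
    have "norm (mexp (t *\<^sub>R A)) \<le> (\<Sum>i\<in>UNIV. norm (mexp (t *\<^sub>R A) $ i))"
      unfolding norm_vec_def by (rule L2_set_le_sum) auto
    also have "\<dots> \<le> (\<Sum>i\<in>UNIV. \<Sum>j\<in>UNIV. \<bar>mexp (t *\<^sub>R A) $ i $ j\<bar>)"
      by (intro sum_mono norm_le_l1_cart)
    also have "\<dots> \<le> (\<Sum>i\<in>(UNIV::'n set). \<Sum>j\<in>UNIV. C j * exp (- m * t))"
      by (intro sum_mono e)
    finally show ?thesis by (simp only: sum_distrib_right)
  qed
  then show ?thesis using m c by (intro that[of m "\<Sum>i\<in>(UNIV :: 'n set). \<Sum>j\<in>UNIV. C j"]) (auto intro!: sum_nonneg mult_nonneg_nonneg)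
qed

section \<open>Square-integrable functions\<close>

lemma integrable_dominated:
  fixes f :: "'a \<Rightarrow> 'b :: {banach, second_countable_topology}" and g :: "'a \<Rightarrow> real"
  assumes "integrable M g" "f \<in> borel_measurable M" "\<And>x. norm (f x) \<le> g x"
  shows "integrable M f"
proof (rule Bochner_Integration.integrable_bound[OF assms(1,2)])
  show "AE x in M. norm (f x) \<le> norm (g x)"
    using assms(3) by (intro AE_I2) (metis abs_ge_self order_trans real_norm_def)
qed

text \<open>One predicate for functions on the line and for random vectors: the isometry compares L2
  of \<open>lborel\<close> with L2 of M, and both sides go through the same limit argument.\<close>

definition square_integrable :: "'a measure \<Rightarrow> ('a \<Rightarrow> 'b :: euclidean_space) \<Rightarrow> bool" where
  "square_integrable M f \<longleftrightarrow> f \<in> borel_measurable M \<and> integrable M (\<lambda>x. (norm (f x))\<^sup>2)"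

lemma square_integrable_measurable: "square_integrable M f \<Longrightarrow> f \<in> borel_measurable M"
  by (simp add: square_integrable_def)

lemma square_integrable_norm: "square_integrable M f \<Longrightarrow> integrable M (\<lambda>x. (norm (f x))\<^sup>2)"
  by (simp add: square_integrable_def)

lemma square_integrable_zero: "square_integrable M (\<lambda>x. 0)"
  by (simp add: square_integrable_def)

lemma square_integrable_bounded_linear:
  assumes "bounded_linear T" and f: "square_integrable M f"
  shows "square_integrable M (\<lambda>x. T (f x))"
proof -
  interpret bounded_linear T by fact
  obtain K where K: "K > 0" "\<And>x. norm (T x) \<le> norm x * K" using pos_bounded by blast
  have T: "T \<in> borel_measurable borel"
    by (intro borel_measurable_continuous_onI linear_continuous_on assms(1))
  have m: "(\<lambda>x. T (f x)) \<in> borel_measurable M"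
    using measurable_compose[OF square_integrable_measurable[OF f] T] .
  have "(norm (T (f x)))\<^sup>2 \<le> K\<^sup>2 * (norm (f x))\<^sup>2" for x
    using power_mono[OF K(2)[of "f x"], of 2] by (simp add: power_mult_distrib mult.commute)
  then have "integrable M (\<lambda>x. (norm (T (f x)))\<^sup>2)"
    using m by (intro integrable_dominated[OF integrable_mult_right[OF square_integrable_norm[OF f], of "K\<^sup>2"]]) simp_all
  then show ?thesis using m by (simp add: square_integrable_def)
qed

lemma square_integrable_add:
  assumes f: "square_integrable M f" and g: "square_integrable M g"
  shows "square_integrable M (\<lambda>x. f x + g x)"
proof -
  note [measurable] = square_integrable_measurable[OF f] square_integrable_measurable[OF g]
  have "(norm (f x + g x))\<^sup>2 \<le> 2 * (norm (f x))\<^sup>2 + 2 * (norm (g x))\<^sup>2" for x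
  proof -
    have "(norm (f x + g x))\<^sup>2 \<le> (norm (f x) + norm (g x))\<^sup>2"
      by (intro power_mono norm_triangle_ineq) simp
    also have "\<dots> \<le> 2 * (norm (f x))\<^sup>2 + 2 * (norm (g x))\<^sup>2"
      using sum_squares_bound[of "norm (f x)" "norm (g x)"] unfolding power2_sum by linarith
    finally show ?thesis .
  qed
  then have "integrable M (\<lambda>x. (norm (f x + g x))\<^sup>2)"
    by (intro integrable_dominated[OF Bochner_Integration.integrable_add[OF
          integrable_mult_right[OF square_integrable_norm[OF f], of 2]
          integrable_mult_right[OF square_integrable_norm[OF g], of 2]]]) simp_all
  then show ?thesis by (simp add: square_integrable_def)
qed

lemma square_integrable_diff:
  assumes f: "square_integrable M f" and g: "square_integrable M g"
  shows "square_integrable M (\<lambda>x. f x - g x)"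
  using square_integrable_add[OF f square_integrable_bounded_linear[OF bounded_linear_minus[OF bounded_linear_ident] g]]
  by simp

lemma square_integrable_inner_left:
  "square_integrable M f \<Longrightarrow> square_integrable M (\<lambda>x. c \<bullet> f x)"
  by (rule square_integrable_bounded_linear[OF bounded_linear_inner_right])

lemma square_integrable_sum:
  assumes "\<And>i. i \<in> I \<Longrightarrow> square_integrable M (f i)"
  shows "square_integrable M (\<lambda>x. \<Sum>i\<in>I. f i x)"
  using assms
  by (induction I rule: infinite_finite_induct)
     (auto simp: square_integrable_zero intro!: square_integrable_add)

lemma integrable_inner_square_integrable:
  assumes f: "square_integrable M f" and g: "square_integrable M g"
  shows "integrable M (\<lambda>x. f x \<bullet> g x)"
proof -
  note [measurable] = square_integrable_measurable[OF f] square_integrable_measurable[OF g]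
  have "\<bar>f x \<bullet> g x\<bar> \<le> (norm (f x))\<^sup>2 + (norm (g x))\<^sup>2" for x
  proof -
    have "\<bar>f x \<bullet> g x\<bar> \<le> norm (f x) * norm (g x)" by (rule Cauchy_Schwarz_ineq2)
    also have "\<dots> \<le> (norm (f x))\<^sup>2 + (norm (g x))\<^sup>2"
      using sum_squares_bound[of "norm (f x)" "norm (g x)"]
        mult_nonneg_nonneg[OF norm_ge_zero[of "f x"] norm_ge_zero[of "g x"]] by linarith
    finally show ?thesis .
  qed
  then show ?thesis
    by (intro integrable_dominated[OF Bochner_Integration.integrable_add[OF
          square_integrable_norm[OF f] square_integrable_norm[OF g]]]) simp_all
qed

text \<open>The integral of the squared norm of \<open>f - r g\<close> is a quadratic polynomial in
  r that is never negative.\<close>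

lemma Cauchy_Schwarz_integral:
  fixes f g :: "'a \<Rightarrow> 'b :: euclidean_space"
  assumes f: "square_integrable M f" and g: "square_integrable M g"
  shows "\<bar>LINT x|M. f x \<bullet> g x\<bar> \<le> sqrt (LINT x|M. (norm (f x))\<^sup>2) * sqrt (LINT x|M. (norm (g x))\<^sup>2)"
proof -
  let ?F = "LINT x|M. (norm (f x))\<^sup>2" and ?G = "LINT x|M. (norm (g x))\<^sup>2" and ?P = "LINT x|M. f x \<bullet> g x"
  note i = square_integrable_norm[OF f] square_integrable_norm[OF g] integrable_inner_square_integrable[OF f g]
  have nn: "?F \<ge> 0" "?G \<ge> 0" by (auto intro: integral_nonneg_AE)
  have q: "0 \<le> ?F - 2 * r * ?P + r\<^sup>2 * ?G" for r
  proof -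
    have "0 \<le> (LINT x|M. (norm (f x - r *\<^sub>R g x))\<^sup>2)" by (auto intro: integral_nonneg_AE)
    also have "\<dots> = (LINT x|M. (norm (f x))\<^sup>2 - 2 * r * (f x \<bullet> g x) + r\<^sup>2 * (norm (g x))\<^sup>2)"
      unfolding power2_norm_eq_inner
      by (intro Bochner_Integration.integral_cong refl)
         (simp add: inner_diff_left inner_diff_right inner_commute[of "g x" "f x" for x] algebra_simps power2_eq_square)
    also have "\<dots> = ?F - 2 * r * ?P + r\<^sup>2 * ?G" using i by simp
    finally show ?thesis .
  qed
  have "?P\<^sup>2 \<le> ?F * ?G"
  proof (cases "?G = 0")
    case True
    have "?P = 0"
    proof (rule ccontr)
      assume "?P \<noteq> 0"
      \<comment> \<open>With \<open>?G = 0\<close> the polynomial is linear in r, and this r gives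
        it the value -1.\<close>
      then show False using q[of "(?F + 1) / (2 * ?P)"] True by (simp add: field_simps)
    qed
    then show ?thesis using nn by simp
  next
    case False
    then have "?G > 0" using nn(2) by (metis order_le_less)
    then have "0 \<le> ?F - ?P\<^sup>2 / ?G"
      using q[of "?P / ?G"] by (simp add: power2_eq_square field_simps)
    then show ?thesis using \<open>?G > 0\<close> by (simp add: field_simps)
  qed
  then have "sqrt (?P\<^sup>2) \<le> sqrt (?F * ?G)" by (rule real_sqrt_le_mono)
  then show ?thesis by (simp add: real_sqrt_mult)
qed

text \<open>Writing \<open>fn\<close> and \<open>gn\<close> as limit minus error leaves three terms,
  each containing an error; Cauchy-Schwarz makes them vanish.\<close>

lemma tendsto_integral_inner_L2:
  fixes f g :: "'a \<Rightarrow> 'b :: euclidean_space"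
  assumes f: "square_integrable M f" and g: "square_integrable M g"
    and fn: "\<And>n::nat. square_integrable M (fn n)" and gn: "\<And>n. square_integrable M (gn n)"
    and lf: "(\<lambda>n. LINT x|M. (norm (f x - fn n x))\<^sup>2) \<longlonglongrightarrow> 0"
    and lg: "(\<lambda>n. LINT x|M. (norm (g x - gn n x))\<^sup>2) \<longlonglongrightarrow> 0"
  shows "(\<lambda>n. LINT x|M. fn n x \<bullet> gn n x) \<longlonglongrightarrow> (LINT x|M. f x \<bullet> g x)"
proof -
  note df = square_integrable_diff[OF f fn] and dg = square_integrable_diff[OF g gn]
  note i = integrable_inner_square_integrable
  let ?S = "\<lambda>h. sqrt (LINT x|M. (norm (h x))\<^sup>2)"
  have sf: "(\<lambda>n. ?S (\<lambda>x. f x - fn n x)) \<longlonglongrightarrow> 0" and sg: "(\<lambda>n. ?S (\<lambda>x. g x - gn n x)) \<longlonglongrightarrow> 0"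
    using tendsto_real_sqrt[OF lf] tendsto_real_sqrt[OF lg] by simp_all
  have "(\<lambda>n. (LINT x|M. fn n x \<bullet> gn n x) - (LINT x|M. f x \<bullet> g x)) \<longlonglongrightarrow> 0"
  proof (rule Lim_null_comparison[OF always_eventually])
    show "\<forall>n. norm ((LINT x|M. fn n x \<bullet> gn n x) - (LINT x|M. f x \<bullet> g x))
      \<le> ?S (\<lambda>x. f x - fn n x) * ?S g + ?S f * ?S (\<lambda>x. g x - gn n x)
         + ?S (\<lambda>x. f x - fn n x) * ?S (\<lambda>x. g x - gn n x)"
    proof
      fix n
      have "(LINT x|M. fn n x \<bullet> gn n x) = (LINT x|M. f x \<bullet> g x - (f x - fn n x) \<bullet> g x - f x \<bullet> (g x - gn n x)
          + (f x - fn n x) \<bullet> (g x - gn n x))"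
        by (intro Bochner_Integration.integral_cong refl) (simp add: algebra_simps)
      also have "\<dots> = (LINT x|M. f x \<bullet> g x) - (LINT x|M. (f x - fn n x) \<bullet> g x)
          - (LINT x|M. f x \<bullet> (g x - gn n x)) + (LINT x|M. (f x - fn n x) \<bullet> (g x - gn n x))"
        using i[OF f g] i[OF df g, of n] i[OF f dg, of n] i[OF df dg, of n n]
        by (simp only: Bochner_Integration.integral_add Bochner_Integration.integral_diff
            Bochner_Integration.integrable_diff)
      finally show "norm ((LINT x|M. fn n x \<bullet> gn n x) - (LINT x|M. f x \<bullet> g x))
        \<le> ?S (\<lambda>x. f x - fn n x) * ?S g + ?S f * ?S (\<lambda>x. g x - gn n x)
         + ?S (\<lambda>x. f x - fn n x) * ?S (\<lambda>x. g x - gn n x)"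
        using Cauchy_Schwarz_integral[OF df g, of n] Cauchy_Schwarz_integral[OF f dg, of n]
          Cauchy_Schwarz_integral[OF df dg, of n n] unfolding real_norm_def by linarith
    qed
    show "(\<lambda>n. ?S (\<lambda>x. f x - fn n x) * ?S g + ?S f * ?S (\<lambda>x. g x - gn n x)
         + ?S (\<lambda>x. f x - fn n x) * ?S (\<lambda>x. g x - gn n x)) \<longlonglongrightarrow> 0"
      using tendsto_add[OF tendsto_add[OF tendsto_mult_right[OF sf, of "?S g"] tendsto_mult_left[OF sg, of "?S f"]]
          tendsto_mult[OF sf sg]] by simp
  qed
  then show ?thesis using Lim_null by blast
qed

text \<open>Carries the vector-valued limits in \<open>has_wiener_integral\<close> over to pairings
  with a fixed vector, on the probability space as well as on the line. The operator bound of T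
  enters squared.\<close>

lemma tendsto_L2_bounded_linear:
  fixes T :: "'b :: euclidean_space \<Rightarrow> 'c :: euclidean_space"
  assumes "bounded_linear T"
    and f: "square_integrable M f" and fn: "\<And>n::nat. square_integrable M (fn n)"
    and l: "(\<lambda>n. LINT x|M. (norm (f x - fn n x))\<^sup>2) \<longlonglongrightarrow> 0"
  shows "(\<lambda>n. LINT x|M. (norm (T (f x) - T (fn n x)))\<^sup>2) \<longlonglongrightarrow> 0"
proof -
  interpret bounded_linear T by fact
  obtain K where K: "K > 0" "\<And>x. norm (T x) \<le> norm x * K" using pos_bounded by blast
  have b: "(LINT x|M. (norm (T (f x) - T (fn n x)))\<^sup>2) \<le> K\<^sup>2 * (LINT x|M. (norm (f x - fn n x))\<^sup>2)" for n
  proof -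
    have "(norm (T (f x) - T (fn n x)))\<^sup>2 \<le> K\<^sup>2 * (norm (f x - fn n x))\<^sup>2" for x
      using power_mono[OF K(2)[of "f x - fn n x"], of 2] by (simp add: diff power_mult_distrib mult.commute)
    then have "(LINT x|M. (norm (T (f x) - T (fn n x)))\<^sup>2) \<le> (LINT x|M. K\<^sup>2 * (norm (f x - fn n x))\<^sup>2)"
      using square_integrable_norm[OF square_integrable_diff[OF f fn[of n]]]
        square_integrable_norm[OF square_integrable_bounded_linear[OF assms(1) square_integrable_diff[OF f fn[of n]]]]
      by (intro integral_mono) (auto simp: diff)
    then show ?thesis by simp
  qed
  show ?thesis
    by (rule tendsto_sandwich[OF _ _ tendsto_const, where h = "\<lambda>n. K\<^sup>2 * (LINT x|M. (norm (f x - fn n x))\<^sup>2)"])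
       (use b tendsto_mult_left[OF l, of "K\<^sup>2"] in \<open>auto intro!: always_eventually integral_nonneg_AE\<close>)
qed

section \<open>The Wiener isometry\<close>

lemma brownian_motion_prob_space: "brownian_motion M W \<Longrightarrow> prob_space M"
  by (simp add: brownian_motion_def)

section \<open>Second moments of Brownian increments and of step integrals\<close>

context
  fixes M :: "'w measure" and W :: "real \<Rightarrow> 'w \<Rightarrow> real ^ 'm"
  assumes bm: "brownian_motion M W"
begin

interpretation prob_space M by (rule brownian_motion_prob_space[OF bm])

lemma increment_moments:
  assumes "l < u"
  shows "integrable M (\<lambda>x. (W u x - W l x) $ j)"
    and "square_integrable M (\<lambda>x. (W u x - W l x) $ j)"
    and "(LINT x|M. (W u x - W l x) $ j) = 0"
    and "(LINT x|M. (W u x - W l x) $ j * (W u x - W l x) $ k) = (if j = k then u - l else 0)"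
proof -
  have D: "distributed M lborel (\<lambda>x. (W u x - W l x) $ j) (normal_density 0 (sqrt (u - l)))" for j
    using bm assms by (simp add: brownian_motion_def)
  have s: "sqrt (u - l) > 0" using assms by simp
  show i: "integrable M (\<lambda>x. (W u x - W l x) $ j)" for j
    by (rule distributed_integrable_var[OF D]) (use integrable_normal_moment_nz_1[OF s] in auto)
  show e: "(LINT x|M. (W u x - W l x) $ j) = 0" for j
    by (rule normal_distributed_expectation[OF s D])
  have "integrable M (\<lambda>x. ((W u x - W l x) $ j)\<^sup>2)" for j
    using distributed_integrable[OF D, of "\<lambda>x. x\<^sup>2"] integrable_normal_moment[OF s, of 0 2] by simp
  then show "square_integrable M (\<lambda>x. (W u x - W l x) $ j)"
    using distributed_measurable[OF D] by (simp add: square_integrable_def del: vector_minus_component)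
  show "(LINT x|M. (W u x - W l x) $ j * (W u x - W l x) $ k) = (if j = k then u - l else 0)"
  proof (cases "j = k")
    case True
    then show ?thesis
      using normal_distributed_variance[OF s D[of j]] e[of j] assms by (simp add: power2_eq_square)
  next
    case False
    have "indep_vars (\<lambda>_. borel) (\<lambda>j x. (W u x - W l x) $ j) UNIV"
      using bm assms by (simp add: brownian_motion_def)
    then have "indep_vars (\<lambda>_. borel) (\<lambda>j x. (W u x - W l x) $ j) {j, k}"
      by (rule indep_vars_subset) simp
    from indep_vars_lebesgue_integral[OF _ this i] show ?thesis
      using False by (simp add: e del: vector_minus_component)
  qed
qed

lemma increment_square_integrable: "square_integrable M (\<lambda>x. (W u x - W l x) $ j)"
proof (cases "l < u")
  case False
  show ?thesis
  proof (cases "l = u")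
    case False
    with \<open>\<not> l < u\<close> have "u < l" by simp
    from square_integrable_bounded_linear[OF bounded_linear_minus[OF bounded_linear_ident] increment_moments(2)[OF this]]
    show ?thesis by simp
  qed (simp add: square_integrable_zero)
qed (rule increment_moments)

lemma increment_integral_zero:
  assumes "l \<le> u"
  shows "(LINT x|M. (W u x - W l x) $ j) = 0"
  using increment_moments(3)[of l u j] assms by (cases "l = u") auto

lemma integrable_increment_mult:
  "integrable M (\<lambda>x. (W u x - W l x) $ j * (W u' x - W l' x) $ k)"
  using integrable_inner_square_integrable[OF increment_square_integrable increment_square_integrable]
  by simp

lemma increment_disjoint:
  assumes "r < s" "s < t"
  shows "(LINT x|M. (W s x - W r x) $ j * (W t x - W s x) $ k) = 0"
proof -
  \<comment> \<open>Independence of increments is given for points of a sequence; here they are r,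
    s, t, continued with unit spacing so that p is defined at every index.\<close>
  define p where "p i = (if i = 0 then r else if i = 1 then s else t + (real i - 2))" for i :: nat
  have "p i < p (Suc i)" if "i < 2" for i
    using that assms by (auto simp: p_def less_2_cases_iff)
  then have "indep_vars (\<lambda>_. borel) (\<lambda>i x. W (p (Suc i)) x - W (p i) x) {..<2}"
    using bm by (simp add: brownian_motion_def)
  from indep_vars_compose2[OF this, of "\<lambda>i v. v $ (if i = 0 then j else k)" "\<lambda>_. borel"]
  have iv: "indep_vars (\<lambda>_. borel) (\<lambda>i x. (W (p (Suc i)) x - W (p i) x) $ (if i = 0 then j else k)) {..<2}"
    by simp
  have ii: "integrable M (\<lambda>x. (W (p (Suc i)) x - W (p i) x) $ (if i = 0 then j else k))" if "i \<in> {..<2}" for i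
    using that assms by (intro increment_moments) (auto simp: p_def less_2_cases_iff)
  have "{..<2::nat} = {0, 1}" by auto
  with indep_vars_lebesgue_integral[OF _ iv ii] increment_moments(3)[OF assms(1), of j]
  show ?thesis by (simp add: p_def)
qed

text \<open>The longer increment is cut at the earlier endpoint: the first piece repeats the shorter
  increment, the second is uncorrelated with it.\<close>

lemma increment_common_origin:
  assumes "r < s" "r < t"
  shows "(LINT x|M. (W s x - W r x) $ j * (W t x - W r x) $ k) = (if j = k then min s t - r else 0)"
proof -
  have *: "(LINT x|M. (W s x - W r x) $ j * (W t x - W r x) $ k) = (if j = k then s - r else 0)"
    if "r < s" "s < t" for s t j k
  proof -
    have "(LINT x|M. (W s x - W r x) $ j * (W t x - W r x) $ k) =
      (LINT x|M. (W s x - W r x) $ j * (W s x - W r x) $ k + (W s x - W r x) $ j * (W t x - W s x) $ k)"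
      by (intro Bochner_Integration.integral_cong refl) (simp add: algebra_simps)
    also have "\<dots> = (LINT x|M. (W s x - W r x) $ j * (W s x - W r x) $ k) +
        (LINT x|M. (W s x - W r x) $ j * (W t x - W s x) $ k)"
      by (intro Bochner_Integration.integral_add integrable_increment_mult)
    finally show ?thesis
      using increment_disjoint[OF that] increment_moments(4)[OF that(1)] by simp
  qed
  consider "s < t" | "s = t" | "t < s" by linarith
  then show ?thesis
  proof cases
    case 3
    have "(LINT x|M. (W s x - W r x) $ j * (W t x - W r x) $ k) =
      (LINT x|M. (W t x - W r x) $ k * (W s x - W r x) $ j)" by (simp only: mult.commute)
    with *[OF assms(2) 3] 3 show ?thesis by auto
  qed (use * increment_moments(4) assms in auto)
qed

text \<open>Both increments are differences of increments with a common left end, so the covariance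
  is an alternating sum of minima, which is the length of the overlap.\<close>

lemma increment_covariance:
  assumes "l \<le> u" "l' \<le> u'"
  shows "(LINT x|M. (W u x - W l x) $ j * (W u' x - W l' x) $ k) =
    (if j = k then measure lborel ({l<..u} \<inter> {l'<..u'}) else 0)"
proof -
  \<comment> \<open>Subtracting 1 puts r strictly to the left of all four endpoints, as
    \<open>increment_common_origin\<close> demands.\<close>
  define r where "r = min l l' - 1"
  have r: "r < l" "r < l'" "r < u" "r < u'" using assms by (auto simp: r_def)
  let ?D = "\<lambda>s t x. (W s x - W r x) $ j * (W t x - W r x) $ k"
  have "(LINT x|M. (W u x - W l x) $ j * (W u' x - W l' x) $ k) =
      (LINT x|M. (?D u u' x - ?D u l' x) - (?D l u' x - ?D l l' x))"
    by (intro Bochner_Integration.integral_cong refl) (simp add: algebra_simps)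
  also have "\<dots> = ((LINT x|M. ?D u u' x) - (LINT x|M. ?D u l' x)) -
       ((LINT x|M. ?D l u' x) - (LINT x|M. ?D l l' x))"
    by (simp only: Bochner_Integration.integral_diff Bochner_Integration.integrable_diff integrable_increment_mult)
  also have "\<dots> = (if j = k then min u u' - min u l' - min l u' + min l l' else 0)"
    by (simp add: increment_common_origin r del: vector_minus_component)
  also have "{l<..u} \<inter> {l'<..u'} = {max l l'<..min u u'}" by auto
  then have "measure lborel ({l<..u} \<inter> {l'<..u'}) = max 0 (min u u' - max l l')"
    by (cases "max l l' \<le> min u u'") auto
  then have "min u u' - min u l' - min l u' + min l l' = measure lborel ({l<..u} \<inter> {l'<..u'})"
    using assms by (auto simp: min_def max_def)
  finally show ?thesis by simp
qed

text \<open>The Ito isometry for one interval on each side. C and D may have different numbers of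
  rows; transposition moves them onto p and q, so that the inner products live in the space of the
  noise.\<close>

lemma single_step_covariance:
  fixes C :: "real ^ 'm ^ 'n" and D :: "real ^ 'm ^ 'k"
  assumes "l \<le> u" "l' \<le> u'"
  shows "(LINT x|M. (p \<bullet> (C *v (W u x - W l x))) * (q \<bullet> (D *v (W u' x - W l' x)))) =
    (LINT s|lborel. (transpose (indicator {l<..u} s *\<^sub>R C) *v p) \<bullet> (transpose (indicator {l'<..u'} s *\<^sub>R D) *v q))"
proof -
  let ?c = "transpose C *v p" and ?d = "transpose D *v q"
  let ?I = "{l<..u} \<inter> {l'<..u'}"
  have c: "p \<bullet> (C *v v) = (\<Sum>j\<in>UNIV. ?c $ j * v $ j)" for v
  proof -
    have "p \<bullet> (C *v v) = ?c \<bullet> v" by (simp add: dot_lmul_matrix)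
    then show ?thesis by (simp only: inner_vec_def inner_real_def)
  qed
  have d: "q \<bullet> (D *v v) = (\<Sum>j\<in>UNIV. ?d $ j * v $ j)" for v
  proof -
    have "q \<bullet> (D *v v) = ?d \<bullet> v" by (simp add: dot_lmul_matrix)
    then show ?thesis by (simp only: inner_vec_def inner_real_def)
  qed
  have "(LINT x|M. (p \<bullet> (C *v (W u x - W l x))) * (q \<bullet> (D *v (W u' x - W l' x)))) =
     (LINT x|M. (\<Sum>j\<in>UNIV. \<Sum>k\<in>UNIV. (?c $ j * ?d $ k) * ((W u x - W l x) $ j * (W u' x - W l' x) $ k)))"
    unfolding c d sum_product
    by (intro Bochner_Integration.integral_cong sum.cong refl) (simp add: mult_ac del: vector_minus_component)
  also have "\<dots> = (\<Sum>j\<in>UNIV. \<Sum>k\<in>UNIV. (?c $ j * ?d $ k) * (if j = k then measure lborel ?I else 0))"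
    using integrable_increment_mult
    by (simp add: increment_covariance[OF assms] del: vector_minus_component)
  also have "\<dots> = (?c \<bullet> ?d) * measure lborel ?I"
    by (simp add: inner_vec_def sum_distrib_right if_distrib cong: if_cong)
  also have "\<dots> = (LINT s|lborel. indicator ?I s *\<^sub>R (?c \<bullet> ?d))"
  proof -
    have "bounded ?I" by (rule bounded_subset[of "{l..u}"]) auto
    then have "emeasure lborel ?I < \<infinity>" by (rule emeasure_bounded_finite)
    then have "integrable lborel (indicator ?I :: real \<Rightarrow> real)" by (intro integrable_real_indicator) auto
    then show ?thesis by (subst integral_scaleR_left) (auto simp: mult.commute)
  qed
  also have "\<dots> = (LINT s|lborel. (transpose (indicator {l<..u} s *\<^sub>R C) *v p) \<bullet> (transpose (indicator {l'<..u'} s *\<^sub>R D) *v q))"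
    by (intro Bochner_Integration.integral_cong refl)
       (auto simp: transpose_scalar scaleR_matrix_vector_assoc[symmetric] split: split_indicator)
  finally show ?thesis .
qed

lemma increment_image_square_integrable: "square_integrable M (\<lambda>x. C *v (W u x - W l x))"
proof -
  have "square_integrable M (\<lambda>x. \<Sum>j\<in>UNIV. (W u x - W l x) $ j *\<^sub>R column j C)"
    by (intro square_integrable_sum
        square_integrable_bounded_linear[OF bounded_linear_scaleR_left increment_square_integrable])
  then show ?thesis
    unfolding matrix_mult_sum scalar_mult_eq_scaleR .
qed

lemma step_integral_square_integrable: "square_integrable M (step_integral W xs)"
proof (induction xs)
  case Nil
  then show ?case by (simp add: step_integral_def[abs_def] square_integrable_zero)
next
  case (Cons y xs)
  obtain C l u where y: "y = (C, l, u)" by (cases y)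
  have "step_integral W (y # xs) = (\<lambda>x. C *v (W u x - W l x) + step_integral W xs x)"
    by (simp add: y step_integral_def[abs_def])
  then show ?case
    using square_integrable_add[OF increment_image_square_integrable Cons] by simp
qed

lemma step_integral_mean:
  assumes "\<forall>(C, l, u) \<in> set xs. l \<le> u"
  shows "(LINT x|M. p \<bullet> step_integral W xs x) = 0"
  using assms
proof (induction xs)
  case (Cons y xs)
  obtain C l u where y: "y = (C, l, u)" by (cases y)
  let ?c = "transpose C *v p"
  have int: "integrable M f" if "square_integrable M f" for f :: "'w \<Rightarrow> real"
    using that by (rule_tac square_integrable_imp_integrable) (simp_all add: square_integrable_def)
  have "(LINT x|M. p \<bullet> (C *v (W u x - W l x))) = (LINT x|M. (\<Sum>j\<in>UNIV. ?c $ j * (W u x - W l x) $ j))"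
  proof (intro Bochner_Integration.integral_cong refl)
    fix x
    have "p \<bullet> (C *v (W u x - W l x)) = ?c \<bullet> (W u x - W l x)" by (simp add: dot_lmul_matrix)
    then show "p \<bullet> (C *v (W u x - W l x)) = (\<Sum>j\<in>UNIV. ?c $ j * (W u x - W l x) $ j)"
      by (simp only: inner_vec_def inner_real_def)
  qed
  also have "\<dots> = (\<Sum>j\<in>UNIV. ?c $ j * (LINT x|M. (W u x - W l x) $ j))"
    using int[OF increment_square_integrable]
    by (subst Bochner_Integration.integral_sum) (simp_all del: vector_minus_component)
  also have "\<dots> = 0" using Cons.prems increment_integral_zero by (simp add: y del: vector_minus_component)
  finally have 0: "(LINT x|M. p \<bullet> (C *v (W u x - W l x))) = 0" .
  have "(LINT x|M. p \<bullet> step_integral W (y # xs) x) =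
      (LINT x|M. p \<bullet> (C *v (W u x - W l x)) + p \<bullet> step_integral W xs x)"
    by (simp add: y step_integral_def inner_add_right)
  also have "\<dots> = 0"
    using Cons 0 int[OF square_integrable_inner_left[OF increment_image_square_integrable, of p C u l]]
      int[OF square_integrable_inner_left[OF step_integral_square_integrable, of p xs]]
    by (subst Bochner_Integration.integral_add) simp_all
  finally show ?case .
qed (simp add: step_integral_def)

end

section \<open>Square integrability of step functions\<close>

lemma indicator_scaleR_square_integrable:
  "square_integrable lborel (\<lambda>s. indicator {l<..u :: real} s *\<^sub>R C)"
proof -
  have "integrable lborel (\<lambda>s. indicator {l<..u} s *\<^sub>R (norm C)\<^sup>2)"
  proof (intro integrable_scaleR_left integrable_real_indicator)
    show "emeasure lborel {l<..u} < \<infinity>"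
      by (rule emeasure_bounded_finite, rule bounded_subset[of "{l..u}"]) auto
  qed simp
  moreover have "(\<lambda>s. (norm (indicator {l<..u} s *\<^sub>R C))\<^sup>2) = (\<lambda>s. indicator {l<..u} s *\<^sub>R (norm C)\<^sup>2)"
    by (auto simp: fun_eq_iff split: split_indicator)
  ultimately show ?thesis by (simp add: square_integrable_def)
qed

lemma step_fun_square_integrable: "square_integrable lborel (step_fun xs)"
proof (induction xs)
  case Nil
  then show ?case by (simp add: step_fun_def[abs_def] square_integrable_zero)
next
  case (Cons y xs)
  obtain C l u where y: "y = (C, l, u)" by (cases y)
  have "step_fun (y # xs) = (\<lambda>s. indicator {l<..u} s *\<^sub>R C + step_fun xs s)"
    by (simp add: y step_fun_def[abs_def])
  then show ?case
    using square_integrable_add[OF indicator_scaleR_square_integrable Cons] by simp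
qed

lemma bounded_linear_transpose_vector:
  "bounded_linear (\<lambda>A :: real ^ 'm ^ 'n. transpose A *v p)"
  unfolding linear_conv_bounded_linear[symmetric]
  by (auto intro!: linearI simp: vec_eq_iff matrix_vector_mult_def transpose_def sum.distrib algebra_simps
      sum_distrib_left)

lemma wiener_square_integrable:
  assumes "has_wiener_integral M W F X"
  shows "square_integrable lborel F" "square_integrable M X"
  using assms by (auto simp: has_wiener_integral_def square_integrable_def)

section \<open>The isometry for step functions and its extension to L2 limits\<close>

context
  fixes M :: "'w measure" and W :: "real \<Rightarrow> 'w \<Rightarrow> real ^ 'm"
  assumes bm: "brownian_motion M W"
begin

text \<open>Only the first factor is expanded; the second is any random variable V matched with any
  function h on the line. The same induction thus serves the other list after the factors are
  exchanged.\<close>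

lemma step_covariance_induct:
  fixes V :: "'w \<Rightarrow> real" and xs :: "((real ^ 'm ^ 'n) \<times> real \<times> real) list"
  assumes V: "square_integrable M V" and h: "square_integrable lborel h"
    and eq: "\<And>C l u. (C, l, u) \<in> set xs \<Longrightarrow> (LINT x|M. (p \<bullet> (C *v (W u x - W l x))) * V x) =
       (LINT s|lborel. (transpose (indicator {l<..u} s *\<^sub>R C) *v p) \<bullet> h s)"
  shows "(LINT x|M. (p \<bullet> step_integral W xs x) * V x) = (LINT s|lborel. (transpose (step_fun xs s) *v p) \<bullet> h s)"
  using eq
proof (induction xs)
  case (Cons y xs)
  obtain C l u where y: "y = (C, l, u)" by (cases y)
  have int: "integrable M (\<lambda>x. (p \<bullet> f x) * V x)" if "square_integrable M f" for f
    using integrable_inner_square_integrable[OF square_integrable_inner_left[OF that, of p] V] by (simp only: inner_real_def)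
  have int': "integrable lborel (\<lambda>s. (transpose (f s) *v p) \<bullet> h s)" if "square_integrable lborel f" for f
    using integrable_inner_square_integrable[OF square_integrable_bounded_linear[OF
          bounded_linear_transpose_vector that] h] .
  have "(LINT x|M. (p \<bullet> step_integral W (y # xs) x) * V x) =
      (LINT x|M. (p \<bullet> (C *v (W u x - W l x))) * V x + (p \<bullet> step_integral W xs x) * V x)"
    by (simp add: y step_integral_def inner_add_right distrib_right)
  also have "\<dots> = (LINT x|M. (p \<bullet> (C *v (W u x - W l x))) * V x) + (LINT x|M. (p \<bullet> step_integral W xs x) * V x)"
    by (intro Bochner_Integration.integral_add int increment_image_square_integrable[OF bm]
        step_integral_square_integrable[OF bm])
  also have "\<dots> = (LINT s|lborel. (transpose (indicator {l<..u} s *\<^sub>R C) *v p) \<bullet> h s)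
       + (LINT s|lborel. (transpose (step_fun xs s) *v p) \<bullet> h s)"
    using Cons by (simp only: y) simp
  also have "\<dots> = (LINT s|lborel. (transpose (indicator {l<..u} s *\<^sub>R C) *v p) \<bullet> h s
       + (transpose (step_fun xs s) *v p) \<bullet> h s)"
    by (intro Bochner_Integration.integral_add[symmetric] int' indicator_scaleR_square_integrable
        step_fun_square_integrable)
  also have "\<dots> = (LINT s|lborel. (transpose (step_fun (y # xs) s) *v p) \<bullet> h s)"
  proof (intro Bochner_Integration.integral_cong refl)
    fix s
    have "step_fun (y # xs) s = indicator {l<..u} s *\<^sub>R C + step_fun xs s"
      by (simp add: y step_fun_def)
    then show "(transpose (indicator {l<..u} s *\<^sub>R C) *v p) \<bullet> h s + (transpose (step_fun xs s) *v p) \<bullet> h s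
        = (transpose (step_fun (y # xs) s) *v p) \<bullet> h s"
      by (simp only: linear_add[OF bounded_linear.linear[OF bounded_linear_transpose_vector]] inner_add_left)
  qed
  finally show ?case .
next
  case Nil
  have "step_fun [] s = (0 :: real ^ 'm ^ 'n)" for s by (simp add: step_fun_def)
  then have "transpose (step_fun [] s :: real ^ 'm ^ 'n) *v p = 0" for s
    by (simp only: linear_0[OF bounded_linear.linear[OF bounded_linear_transpose_vector]])
  then show ?case by (simp only: step_integral_def) simp
qed

lemma step_covariance:
  assumes xs: "\<forall>(C, l, u) \<in> set xs. l \<le> u" and ys: "\<forall>(C, l, u) \<in> set ys. l \<le> u"
  shows "(LINT x|M. (p \<bullet> step_integral W xs x) * (q \<bullet> step_integral W ys x)) =
    (LINT s|lborel. (transpose (step_fun xs s) *v p) \<bullet> (transpose (step_fun ys s) *v q))"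
proof (rule step_covariance_induct)
  show "square_integrable M (\<lambda>x. q \<bullet> step_integral W ys x)"
    by (intro square_integrable_inner_left step_integral_square_integrable[OF bm])
  show "square_integrable lborel (\<lambda>s. transpose (step_fun ys s) *v q)"
    by (rule square_integrable_bounded_linear[OF bounded_linear_transpose_vector step_fun_square_integrable])
  fix C l u assume C: "(C, l, u) \<in> set xs"
  \<comment> \<open>The inner induction runs over \<open>ys\<close>, with the factors exchanged and
    a single interval of \<open>xs\<close> in the role of V and h.\<close>
  have "(LINT x|M. (q \<bullet> step_integral W ys x) * (p \<bullet> (C *v (W u x - W l x)))) =
     (LINT s|lborel. (transpose (step_fun ys s) *v q) \<bullet> (transpose (indicator {l<..u} s *\<^sub>R C) *v p))"
  proof (rule step_covariance_induct)
    show "square_integrable M (\<lambda>x. p \<bullet> (C *v (W u x - W l x)))"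
      by (intro square_integrable_inner_left increment_image_square_integrable[OF bm])
    show "square_integrable lborel (\<lambda>s. transpose (indicator {l<..u} s *\<^sub>R C) *v p)"
      by (rule square_integrable_bounded_linear[OF bounded_linear_transpose_vector indicator_scaleR_square_integrable])
    fix D l' u' assume "(D, l', u') \<in> set ys"
    then show "(LINT x|M. (q \<bullet> (D *v (W u' x - W l' x))) * (p \<bullet> (C *v (W u x - W l x)))) =
       (LINT s|lborel. (transpose (indicator {l'<..u'} s *\<^sub>R D) *v q) \<bullet> (transpose (indicator {l<..u} s *\<^sub>R C) *v p))"
      using C xs ys by (intro single_step_covariance[OF bm]) auto
  qed
  then show "(LINT x|M. (p \<bullet> (C *v (W u x - W l x))) * (q \<bullet> step_integral W ys x)) =
     (LINT s|lborel. (transpose (indicator {l<..u} s *\<^sub>R C) *v p) \<bullet> (transpose (step_fun ys s) *v q))"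
    by (simp only: mult.commute inner_commute)
qed

text \<open>Both sides are continuous under L2 approximation and agree along the approximating
  steps. The value depends on F and G only, so every version of the integrals gives the same
  covariance.\<close>

lemma wiener_covariance:
  assumes X: "has_wiener_integral M W F X" and Y: "has_wiener_integral M W G Y"
  shows "(LINT x|M. (p \<bullet> X x) * (q \<bullet> Y x)) = (LINT s|lborel. (transpose (F s) *v p) \<bullet> (transpose (G s) *v q))"
proof -
  obtain f where f': "\<forall>n. \<forall>(C, l, u) \<in> set (f n). l \<le> u"
    and fF: "(\<lambda>n::nat. LINT s|lborel. (norm (F s - step_fun (f n) s))\<^sup>2) \<longlonglongrightarrow> 0"
    and fX: "(\<lambda>n. LINT x|M. (norm (X x - step_integral W (f n) x))\<^sup>2) \<longlonglongrightarrow> 0"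
    using X unfolding has_wiener_integral_def by blast
  note f = spec[OF f']
  obtain g where g': "\<forall>n. \<forall>(C, l, u) \<in> set (g n). l \<le> u"
    and gG: "(\<lambda>n::nat. LINT s|lborel. (norm (G s - step_fun (g n) s))\<^sup>2) \<longlonglongrightarrow> 0"
    and gY: "(\<lambda>n. LINT x|M. (norm (Y x - step_integral W (g n) x))\<^sup>2) \<longlonglongrightarrow> 0"
    using Y unfolding has_wiener_integral_def by blast
  note g = spec[OF g']
  note F = wiener_square_integrable(1)[OF X] and G = wiener_square_integrable(1)[OF Y]
  note X = wiener_square_integrable(2)[OF X] and Y = wiener_square_integrable(2)[OF Y]
  note S = step_integral_square_integrable[OF bm] and T = step_fun_square_integrable
  note bT = bounded_linear_transpose_vector and bI = bounded_linear_inner_right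
  note sq = square_integrable_bounded_linear and L = tendsto_L2_bounded_linear
  have "(\<lambda>n. LINT x|M. (p \<bullet> step_integral W (f n) x) \<bullet> (q \<bullet> step_integral W (g n) x))
      \<longlonglongrightarrow> (LINT x|M. (p \<bullet> X x) \<bullet> (q \<bullet> Y x))"
    by (rule tendsto_integral_inner_L2[OF sq[OF bI X] sq[OF bI Y] sq[OF bI S] sq[OF bI S]
          L[OF bI X S fX] L[OF bI Y S gY]])
  moreover have "(\<lambda>n. LINT s|lborel. (transpose (step_fun (f n) s) *v p) \<bullet> (transpose (step_fun (g n) s) *v q))
      \<longlonglongrightarrow> (LINT s|lborel. (transpose (F s) *v p) \<bullet> (transpose (G s) *v q))"
    by (rule tendsto_integral_inner_L2[OF sq[OF bT F] sq[OF bT G] sq[OF bT T] sq[OF bT T]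
          L[OF bT F T fF] L[OF bT G T gG]])
  ultimately show ?thesis
    unfolding inner_real_def step_covariance[OF f g] by (rule LIMSEQ_unique)
qed

text \<open>The mean is the L2 inner product with the constant 1, which is square integrable on a
  probability space; step integrals are centred.\<close>

lemma wiener_mean:
  assumes X: "has_wiener_integral M W F X"
  shows "(LINT x|M. p \<bullet> X x) = 0"
proof -
  obtain f where f': "\<forall>n. \<forall>(C, l, u) \<in> set (f n). l \<le> u"
    and fX: "(\<lambda>n::nat. LINT x|M. (norm (X x - step_integral W (f n) x))\<^sup>2) \<longlonglongrightarrow> 0"
    using X unfolding has_wiener_integral_def by blast
  note f = spec[OF f']
  note X = wiener_square_integrable(2)[OF X]
  note S = step_integral_square_integrable[OF bm] and bI = bounded_linear_inner_right
  interpret prob_space M by (rule brownian_motion_prob_space[OF bm])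
  have one: "square_integrable M (\<lambda>x. 1 :: real)" by (simp add: square_integrable_def)
  have "(\<lambda>n. LINT x|M. (p \<bullet> step_integral W (f n) x) \<bullet> 1) \<longlonglongrightarrow> (LINT x|M. (p \<bullet> X x) \<bullet> 1)"
    by (rule tendsto_integral_inner_L2[OF square_integrable_bounded_linear[OF bI X] one
          square_integrable_bounded_linear[OF bI S] one tendsto_L2_bounded_linear[OF bI X S fX]]) simp
  then show ?thesis
    by (simp add: step_integral_mean[OF bm f] LIMSEQ_const_iff)
qed

end

section \<open>Fourier transforms of convolutions\<close>

text \<open>Unnormalised: the factor 1/(2\<pi>) is left to \<open>psd\<close>, and convolutions
  become products without a constant.\<close>

definition fourier :: "(real \<Rightarrow> real) \<Rightarrow> real \<Rightarrow> complex" where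
  "fourier f \<omega> = (LINT t|lborel. of_real (f t) * exp (- \<i> * of_real \<omega> * of_real t))"

definition convolve :: "(real \<Rightarrow> real) \<Rightarrow> (real \<Rightarrow> real) \<Rightarrow> real \<Rightarrow> real" where
  "convolve f g t = (LINT x|lborel. f x * g (t - x))"

lemma norm_exp_imaginary: "norm (exp (- \<i> * of_real \<omega> * of_real t)) = 1"
  by (simp add: norm_exp_eq_Re)

lemma fourier_integrable:
  assumes "integrable lborel f"
  shows "integrable lborel (\<lambda>t. of_real (f t) * exp (- \<i> * of_real \<omega> * of_real t) :: complex)"
proof (rule integrable_dominated[OF integrable_norm[OF assms]])
  show "(\<lambda>t. of_real (f t) * exp (- \<i> * of_real \<omega> * of_real t) :: complex) \<in> borel_measurable lborel"
    using borel_measurable_integrable[OF assms] by measurable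
  show "norm (of_real (f t) * exp (- \<i> * of_real \<omega> * of_real t) :: complex) \<le> norm (f t)" for t
    unfolding norm_mult norm_exp_imaginary by simp
qed

lemma fourier_add:
  assumes "integrable lborel f" "integrable lborel g"
  shows "fourier (\<lambda>t. f t + g t) \<omega> = fourier f \<omega> + fourier g \<omega>"
  unfolding fourier_def
  by (subst Bochner_Integration.integral_add[symmetric])
     (simp_all only: fourier_integrable assms of_real_add distrib_right)

lemma fourier_cmult: "fourier (\<lambda>t. c * f t) \<omega> = of_real c * fourier f \<omega>"
  unfolding fourier_def by (simp only: of_real_mult mult.assoc integral_mult_right_zero)

lemma fourier_reflect: "fourier (\<lambda>t. f (- t)) \<omega> = fourier f (- \<omega>)"
  unfolding fourier_def
  by (subst lborel_integral_real_affine[where c="-1" and t=0]) simp_all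

text \<open>By translation invariance the inner integral of the absolute value is |f x| times the L1
  norm of g, which is integrable in x.\<close>

lemma convolve_pair_integrable:
  fixes f g :: "real \<Rightarrow> real"
  assumes f: "integrable lborel f" and g: "integrable lborel g"
  shows "integrable (lborel \<Otimes>\<^sub>M lborel) (\<lambda>(x, t). f x * g (t - x))"
proof (rule lborel_pair.Fubini_integrable)
  have [measurable]: "f \<in> borel_measurable borel" "g \<in> borel_measurable borel"
    using borel_measurable_integrable[OF f] borel_measurable_integrable[OF g] by simp_all
  have gx: "integrable lborel (\<lambda>t. g (t - x))" for x
    using lborel_integrable_real_affine[OF g, of 1 "-x"] by simp
  show "(\<lambda>(x, t). f x * g (t - x)) \<in> borel_measurable (lborel \<Otimes>\<^sub>M lborel)" by measurable
  show "AE x in lborel. integrable lborel (\<lambda>t. case (x, t) of (x, t) \<Rightarrow> f x * g (t - x))"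
    using gx by simp
  have "(LINT t|lborel. norm (g (t - x))) = (LINT t|lborel. norm (g t))" for x
    by (subst lborel_integral_real_affine[where c=1 and t=x]) simp_all
  then have "(LINT t|lborel. norm (case (x, t) of (x, t) \<Rightarrow> f x * g (t - x)))
      = norm (f x) * (LINT t|lborel. norm (g t))" for x
    by (simp add: abs_mult)
  then show "integrable lborel (\<lambda>x. LINT t|lborel. norm (case (x, t) of (x, t) \<Rightarrow> f x * g (t - x)))"
    using f by simp
qed

lemma convolve_integrable:
  fixes f g :: "real \<Rightarrow> real"
  assumes f: "integrable lborel f" and g: "integrable lborel g"
  shows "integrable lborel (convolve f g)"
  using lborel_pair.integrable_snd[OF convolve_pair_integrable[OF assms]]
  by (simp add: convolve_def[abs_def])

lemma fourier_convolve:
  fixes f g :: "real \<Rightarrow> real"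
  assumes f: "integrable lborel f" and g: "integrable lborel g"
  shows "fourier (convolve f g) \<omega> = fourier f \<omega> * fourier g \<omega>"
proof -
  let ?e = "\<lambda>t. exp (- \<i> * of_real \<omega> * of_real t) :: complex"
  have [measurable]: "f \<in> borel_measurable borel" "g \<in> borel_measurable borel"
    using borel_measurable_integrable[OF f] borel_measurable_integrable[OF g] by simp_all
  have i: "integrable (lborel \<Otimes>\<^sub>M lborel) (\<lambda>(x, t). of_real (f x * g (t - x)) * ?e t)"
  proof (rule Bochner_Integration.integrable_bound[OF convolve_pair_integrable[OF f g]])
    show "(\<lambda>(x, t). of_real (f x * g (t - x)) * ?e t) \<in> borel_measurable (lborel \<Otimes>\<^sub>M lborel)" by measurable
    show "AE x in lborel \<Otimes>\<^sub>M lborel. norm (case x of (x, t) \<Rightarrow> of_real (f x * g (t - x)) * ?e t)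
        \<le> norm (case x of (x, t) \<Rightarrow> f x * g (t - x))"
    proof (intro AE_I2)
      fix y :: "real \<times> real"
      show "norm (case y of (x, t) \<Rightarrow> of_real (f x * g (t - x)) * ?e t)
        \<le> norm (case y of (x, t) \<Rightarrow> f x * g (t - x))"
        by (cases y) (simp only: prod.case norm_mult norm_exp_imaginary norm_of_real, simp add: abs_mult)
    qed
  qed
  have "fourier (convolve f g) \<omega> = (LINT t|lborel. LINT x|lborel. of_real (f x * g (t - x)) * ?e t)"
    unfolding fourier_def convolve_def
    by (simp only: integral_mult_left_zero integral_complex_of_real)
  also have "\<dots> = (LINT x|lborel. LINT t|lborel. of_real (f x * g (t - x)) * ?e t)"
    by (rule lborel_pair.Fubini_integral[OF i])
  also have "\<dots> = (LINT x|lborel. of_real (f x) * ?e x * fourier g \<omega>)"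
  proof (intro Bochner_Integration.integral_cong refl)
    fix x
    \<comment> \<open>Translating t by x splits the exponential into a factor in x and a factor in
      t.\<close>
    have "(LINT t|lborel. of_real (f x * g (t - x)) * ?e t) =
       (LINT t|lborel. of_real (f x * g t) * ?e (x + t))"
      by (subst lborel_integral_real_affine[where c=1 and t=x]) simp_all
    also have "\<dots> = (LINT t|lborel. (of_real (f x) * ?e x) * (of_real (g t) * ?e t))"
      by (simp add: exp_add[symmetric] exp_diff[symmetric] algebra_simps mult_exp_exp)
    finally show "(LINT t|lborel. of_real (f x * g (t - x)) * ?e t) = of_real (f x) * ?e x * fourier g \<omega>"
      unfolding fourier_def by (simp only: integral_mult_right_zero)
  qed
  also have "\<dots> = fourier f \<omega> * fourier g \<omega>"
    by (simp only: integral_mult_left_zero fourier_def)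
  finally show ?thesis .
qed

section \<open>Transforms of a mollifier under scaling\<close>

lemma rescale_integrable:
  assumes "integrable lborel \<psi>" "\<delta> > 0"
  shows "integrable lborel (rescale \<psi> \<delta>)"
  using lborel_integrable_real_affine[OF assms(1), of "1 / \<delta>" 0] assms(2)
  by (simp add: rescale_def[abs_def])

lemma fourier_rescale:
  assumes "\<delta> > 0"
  shows "fourier (rescale \<psi> \<delta>) \<omega> = fourier \<psi> (\<omega> * \<delta>)"
proof -
  have "fourier (rescale \<psi> \<delta>) \<omega> = of_real \<delta> *
      (LINT t|lborel. of_real (1 / \<delta> * \<psi> t) * exp (- \<i> * of_real \<omega> * of_real (\<delta> * t)))"
    unfolding fourier_def rescale_def
    using assms by (subst lborel_integral_real_affine[where c=\<delta> and t=0]) (simp_all add: scaleR_conv_of_real)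
  also have "\<dots> = (LINT t|lborel. of_real \<delta> *
      (of_real (1 / \<delta> * \<psi> t) * exp (- \<i> * of_real \<omega> * of_real (\<delta> * t))))"
    by (rule integral_mult_right_zero[symmetric])
  also have "\<dots> = fourier \<psi> (\<omega> * \<delta>)"
    unfolding fourier_def
    by (intro Bochner_Integration.integral_cong refl) (use assms in \<open>simp add: mult.assoc\<close>)
  finally show ?thesis .
qed

text \<open>As \<psi> has mass 1 on [-1,1], the distance of its transform at \<eta> from 1 is at
  most an average of |exp(-i\<eta>t) - 1| \<le> |\<eta>t| \<le> |\<eta>|. For the rescaled function
  \<eta> = \<omega>\<delta>, which tends to 0.\<close>

lemma tendsto_fourier_rescale:
  assumes \<psi>: "\<And>t. 0 \<le> \<psi> t" "\<And>t. t \<notin> {-1..1} \<Longrightarrow> \<psi> t = 0" "(LINT t|lborel. \<psi> t) = 1"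
    and i: "integrable lborel \<psi>"
  shows "((\<lambda>\<delta>. fourier (rescale \<psi> \<delta>) \<omega>) \<longlongrightarrow> 1) (at_right 0)"
proof -
  have b: "norm (fourier \<psi> \<eta> - 1) \<le> \<bar>\<eta>\<bar>" for \<eta>
  proof -
    have "1 = (LINT t|lborel. complex_of_real (\<psi> t))"
      using \<psi>(3) by (simp add: integral_complex_of_real)
    then have "fourier \<psi> \<eta> - 1 = (LINT t|lborel. of_real (\<psi> t) * exp (- \<i> * of_real \<eta> * of_real t) - of_real (\<psi> t))"
      unfolding fourier_def using fourier_integrable[OF i, of \<eta>] i
      by (subst Bochner_Integration.integral_diff) simp_all
    also have "norm \<dots> \<le> (LINT t|lborel. norm (complex_of_real (\<psi> t) * exp (- \<i> * of_real \<eta> * of_real t) - of_real (\<psi> t)))"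
      by (rule integral_norm_bound)
    also have "\<dots> \<le> (LINT t|lborel. \<psi> t * \<bar>\<eta>\<bar>)"
    proof (rule integral_mono)
      show "integrable lborel (\<lambda>t. norm (complex_of_real (\<psi> t) * exp (- \<i> * of_real \<eta> * of_real t) - of_real (\<psi> t)))"
        using fourier_integrable[OF i, of \<eta>] i by (intro integrable_norm Bochner_Integration.integrable_diff) simp_all
      show "integrable lborel (\<lambda>t. \<psi> t * \<bar>\<eta>\<bar>)" using i by simp
      fix t
      have "complex_of_real (\<psi> t) * exp (- \<i> * of_real \<eta> * of_real t) - of_real (\<psi> t)
          = of_real (\<psi> t) * (iexp (- \<eta> * t) - 1)" by (simp add: algebra_simps)
      then have "norm (complex_of_real (\<psi> t) * exp (- \<i> * of_real \<eta> * of_real t) - of_real (\<psi> t))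
          = \<psi> t * norm (iexp (- \<eta> * t) - 1)" using \<psi>(1)[of t] by (simp add: norm_mult)
      also have "\<dots> \<le> \<psi> t * (\<bar>\<eta>\<bar> * \<bar>t\<bar>)"
        using iexp_approx1[of "- \<eta> * t" 0] \<psi>(1)[of t] by (intro mult_left_mono) (simp_all add: abs_mult)
      also have "\<dots> \<le> \<psi> t * \<bar>\<eta>\<bar>"
      proof (cases "t \<in> {-1..1}")
        case True
        then have "\<bar>\<eta>\<bar> * \<bar>t\<bar> \<le> \<bar>\<eta>\<bar> * 1" by (intro mult_left_mono) auto
        then show ?thesis using \<psi>(1)[of t] by (intro mult_left_mono) auto
      qed (simp add: \<psi>(2))
      finally show "norm (complex_of_real (\<psi> t) * exp (- \<i> * of_real \<eta> * of_real t) - of_real (\<psi> t)) \<le> \<psi> t * \<bar>\<eta>\<bar>" .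
    qed
    also have "\<dots> = \<bar>\<eta>\<bar>" using \<psi>(3) by simp
    finally show ?thesis .
  qed
  have "((\<lambda>\<delta>. fourier (rescale \<psi> \<delta>) \<omega> - 1) \<longlongrightarrow> 0) (at_right 0)"
  proof (rule Lim_null_comparison)
    show "\<forall>\<^sub>F \<delta> in at_right 0. norm (fourier (rescale \<psi> \<delta>) \<omega> - 1) \<le> \<bar>\<omega> * \<delta>\<bar>"
      using eventually_at_right_less[of 0]
      by eventually_elim (simp only: fourier_rescale b)
    show "((\<lambda>\<delta>. \<bar>\<omega> * \<delta>\<bar>) \<longlongrightarrow> 0) (at_right 0)"
      by (rule tendsto_eq_intros refl | simp)+
  qed
  then show ?thesis by (simp add: Lim_null[symmetric])
qed

section \<open>Weighted time averages of a process\<close>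

text \<open>Rounding time down to the grid of mesh 1/(n+1) leaves countably many random variables,
  so the discretised process is jointly measurable; continuity of every path gives convergence at
  every point.\<close>

lemma continuous_process_measurable:
  fixes V :: "real \<Rightarrow> 'w \<Rightarrow> real"
  assumes [measurable]: "\<And>t. V t \<in> borel_measurable M"
    and cont: "\<And>x. x \<in> space M \<Longrightarrow> continuous_on UNIV (\<lambda>t. V t x)"
  shows "(\<lambda>(t, x). V t x) \<in> borel_measurable (lborel \<Otimes>\<^sub>M M)"
proof (rule borel_measurable_LIMSEQ_metric)
  fix n :: nat
  have "(\<lambda>z. (\<lambda>i z. V (of_int i / real (Suc n)) (snd z)) \<lfloor>real (Suc n) * fst z\<rfloor> z)
      \<in> borel_measurable (lborel \<Otimes>\<^sub>M M)"
    by (rule measurable_compose_countable) measurable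
  then show "(\<lambda>z. V (of_int \<lfloor>real (Suc n) * fst z\<rfloor> / real (Suc n)) (snd z)) \<in> borel_measurable (lborel \<Otimes>\<^sub>M M)"
    by simp
next
  fix z :: "real \<times> 'w" assume z: "z \<in> space (lborel \<Otimes>\<^sub>M M)"
  obtain t x where tx: "z = (t, x)" by (cases z)
  have "(\<lambda>n. of_int \<lfloor>real (Suc n) * t\<rfloor> / real (Suc n)) \<longlonglongrightarrow> t"
  proof (rule tendsto_sandwich[OF always_eventually always_eventually])
    show "\<forall>n. t - 1 / real (Suc n) \<le> of_int \<lfloor>real (Suc n) * t\<rfloor> / real (Suc n)"
    proof
      fix n
      have "real (Suc n) * t - 1 \<le> of_int \<lfloor>real (Suc n) * t\<rfloor>" by linarith
      then have "(real (Suc n) * t - 1) / real (Suc n) \<le> of_int \<lfloor>real (Suc n) * t\<rfloor> / real (Suc n)"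
        by (rule divide_right_mono) simp
      then show "t - 1 / real (Suc n) \<le> of_int \<lfloor>real (Suc n) * t\<rfloor> / real (Suc n)"
        by (simp add: diff_divide_distrib)
    qed
    show "\<forall>n. of_int \<lfloor>real (Suc n) * t\<rfloor> / real (Suc n) \<le> t"
      by (simp add: divide_le_eq mult.commute del: of_nat_Suc)
    show "(\<lambda>n. t - 1 / real (Suc n)) \<longlonglongrightarrow> t"
      using tendsto_diff[OF tendsto_const LIMSEQ_Suc[OF lim_1_over_n], of t] by simp
  qed simp
  moreover have "isCont (\<lambda>t. V t x) t"
    using cont[of x] z tx by (simp add: continuous_on_eq_continuous_at space_pair_measure)
  ultimately show "(\<lambda>n. V (of_int \<lfloor>real (Suc n) * fst z\<rfloor> / real (Suc n)) (snd z)) \<longlonglongrightarrow> (case z of (t, x) \<Rightarrow> V t x)"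
    using isCont_tendsto_compose[of t "\<lambda>t. V t x"] tx by simp
qed

context
  fixes M :: "'w measure" and V :: "real \<Rightarrow> 'w \<Rightarrow> real" and p :: "real \<Rightarrow> real" and K :: real
  assumes M: "prob_space M"
    and Vm: "(\<lambda>(t, x). V t x) \<in> borel_measurable (lborel \<Otimes>\<^sub>M M)"
    and V: "\<And>t. square_integrable M (V t)"
    and K: "\<And>t. (LINT x|M. (V t x)\<^sup>2) \<le> K"
    and p: "integrable lborel p"
begin

text \<open>From |VU| \<le> V^2 + U^2 the expectation of |VU| is bounded uniformly in time, and p is
  integrable. This justifies exchanging time average and expectation.\<close>

lemma weighted_product_integrable:
  assumes U: "square_integrable M U"
  shows "integrable (lborel \<Otimes>\<^sub>M M) (\<lambda>(t, x). p t * (V t x * U x))"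
proof -
  interpret prob_space M by (rule M)
  have sf: "sigma_finite_measure M" ..
  interpret pair_sigma_finite lborel M ..
  note [measurable] = Vm square_integrable_measurable[OF U] borel_measurable_integrable[OF p]
  have VU: "integrable M (\<lambda>x. V t x * U x)" for t
    using integrable_inner_square_integrable[OF V U] by (simp only: inner_real_def)
  let ?C = "K + (LINT x|M. (U x)\<^sup>2)"
  have b: "(LINT x|M. norm (V t x * U x)) \<le> ?C" for t
  proof -
    have "(LINT x|M. norm (V t x * U x)) \<le> (LINT x|M. (V t x)\<^sup>2 + (U x)\<^sup>2)"
    proof (rule integral_mono)
      show "integrable M (\<lambda>x. (V t x)\<^sup>2 + (U x)\<^sup>2)"
        using square_integrable_norm[OF V] square_integrable_norm[OF U] by simp
      fix x
      have "norm (V t x * U x) \<le> 2 * \<bar>V t x\<bar> * \<bar>U x\<bar>" by (simp add: abs_mult)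
      also have "\<dots> \<le> (V t x)\<^sup>2 + (U x)\<^sup>2"
        using sum_squares_bound[of "\<bar>V t x\<bar>" "\<bar>U x\<bar>"] by simp
      finally show "norm (V t x * U x) \<le> (V t x)\<^sup>2 + (U x)\<^sup>2" .
    qed (use VU in auto)
    also have "\<dots> = (LINT x|M. (V t x)\<^sup>2) + (LINT x|M. (U x)\<^sup>2)"
      using square_integrable_norm[OF V] square_integrable_norm[OF U]
      by (intro Bochner_Integration.integral_add) simp_all
    finally show ?thesis using K[of t] by simp
  qed
  show ?thesis
  proof (rule Fubini_integrable)
    show m: "(\<lambda>(t, x). p t * (V t x * U x)) \<in> borel_measurable (lborel \<Otimes>\<^sub>M M)" by measurable
    show "AE t in lborel. integrable M (\<lambda>x. case (t, x) of (t, x) \<Rightarrow> p t * (V t x * U x))"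
      using VU by simp
    show "integrable lborel (\<lambda>t. LINT x|M. norm (case (t, x) of (t, x) \<Rightarrow> p t * (V t x * U x)))"
    proof (rule integrable_dominated[OF integrable_mult_right[OF integrable_norm[OF p], of ?C]])
      have "(\<lambda>(t, x). norm (p t * (V t x * U x))) \<in> borel_measurable (lborel \<Otimes>\<^sub>M M)" by measurable
      from sigma_finite_measure.borel_measurable_lebesgue_integral[OF sf this]
      show "(\<lambda>t. LINT x|M. norm (case (t, x) of (t, x) \<Rightarrow> p t * (V t x * U x))) \<in> borel_measurable lborel"
        by (simp only: prod.case)
      fix t
      have "(LINT x|M. norm (case (t, x) of (t, x) \<Rightarrow> p t * (V t x * U x))) = norm (p t) * (LINT x|M. norm (V t x * U x))"
        by (simp only: prod.case norm_mult[of "p t"] integral_mult_right_zero)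
      moreover have "0 \<le> (LINT x|M. norm (V t x * U x))" by (rule integral_nonneg_AE) simp
      ultimately show "norm (LINT x|M. norm (case (t, x) of (t, x) \<Rightarrow> p t * (V t x * U x))) \<le> ?C * norm (p t)"
        using mult_left_mono[OF b[of t], of "norm (p t)"] by (simp add: mult.commute)
    qed
  qed
qed

lemma time_average_product:
  assumes U: "square_integrable M U"
  shows "(LINT x|M. (LINT t|lborel. V t x * p t) * U x) = (LINT t|lborel. p t * (LINT x|M. V t x * U x))"
proof -
  interpret prob_space M by (rule M)
  interpret pair_sigma_finite lborel M ..
  note i = weighted_product_integrable[OF U]
  have "(LINT x|M. (LINT t|lborel. V t x * p t) * U x) = (LINT x|M. LINT t|lborel. p t * (V t x * U x))"
  proof (intro Bochner_Integration.integral_cong refl)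
    fix x
    \<comment> \<open>The factor moves inside without integrability of the path, since the Bochner
      integral of a non-integrable function is 0; hence no exceptional set of paths arises.\<close>
    have "(LINT t|lborel. V t x * p t) * U x = (LINT t|lborel. (V t x * p t) * U x)"
      by (rule integral_mult_left_zero[symmetric])
    then show "(LINT t|lborel. V t x * p t) * U x = (LINT t|lborel. p t * (V t x * U x))"
      by (simp only: mult_ac)
  qed
  also have "\<dots> = (LINT t|lborel. LINT x|M. p t * (V t x * U x))"
    by (rule Fubini_integral[OF i])
  finally show ?thesis
    by (simp only: integral_mult_right_zero)
qed

text \<open>Jensen's inequality for the probability density p: the squared average is at most the
  average of the squares, whose expectation is finite by Fubini and the bound K.\<close>

lemma time_average_square_integrable:
  assumes p0: "\<And>t. 0 \<le> p t" and p1: "(LINT t|lborel. p t) = 1"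
  shows "square_integrable M (\<lambda>x. LINT t|lborel. V t x * p t)"
proof -
  interpret prob_space M by (rule M)
  have sf: "sigma_finite_measure M" ..
  interpret pair_sigma_finite lborel M ..
  interpret Q: pair_sigma_finite M lborel ..
  note [measurable] = Vm borel_measurable_integrable[OF p]
  let ?Y = "\<lambda>x. LINT t|lborel. V t x * p t"
  have V2: "integrable M (\<lambda>x. (V t x)\<^sup>2)" for t using square_integrable_norm[OF V] by simp
  have i: "integrable (lborel \<Otimes>\<^sub>M M) (\<lambda>(t, x). p t * (V t x)\<^sup>2)"
  proof (rule Fubini_integrable)
    show m: "(\<lambda>(t, x). p t * (V t x)\<^sup>2) \<in> borel_measurable (lborel \<Otimes>\<^sub>M M)" by measurable
    show "AE t in lborel. integrable M (\<lambda>x. case (t, x) of (t, x) \<Rightarrow> p t * (V t x)\<^sup>2)"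
      using V2 by simp
    show "integrable lborel (\<lambda>t. LINT x|M. norm (case (t, x) of (t, x) \<Rightarrow> p t * (V t x)\<^sup>2))"
    proof (rule integrable_dominated[OF integrable_mult_right[OF p, of K]])
      have "(\<lambda>(t, x). norm (p t * (V t x)\<^sup>2)) \<in> borel_measurable (lborel \<Otimes>\<^sub>M M)" by measurable
      from sigma_finite_measure.borel_measurable_lebesgue_integral[OF sf this]
      show "(\<lambda>t. LINT x|M. norm (case (t, x) of (t, x) \<Rightarrow> p t * (V t x)\<^sup>2)) \<in> borel_measurable lborel"
        by (simp only: prod.case)
      fix t
      have "(LINT x|M. norm (case (t, x) of (t, x) \<Rightarrow> p t * (V t x)\<^sup>2)) = p t * (LINT x|M. (V t x)\<^sup>2)"
        using p0[of t] by (simp add: abs_mult)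
      moreover have "0 \<le> (LINT x|M. (V t x)\<^sup>2)" by (rule integral_nonneg_AE) simp
      ultimately show "norm (LINT x|M. norm (case (t, x) of (t, x) \<Rightarrow> p t * (V t x)\<^sup>2)) \<le> K * p t"
        using mult_left_mono[OF K[of t] p0[of t]] p0[of t] by (simp add: mult.commute)
    qed
  qed
  have m: "?Y \<in> borel_measurable M"
  proof (rule lborel.borel_measurable_lebesgue_integral)
    have "(\<lambda>z. (\<lambda>(t, x). V t x * p t) (snd z, fst z)) \<in> borel_measurable (M \<Otimes>\<^sub>M lborel)" by measurable
    then show "(\<lambda>(x, t). V t x * p t) \<in> borel_measurable (M \<Otimes>\<^sub>M lborel)" by (simp add: case_prod_beta')
  qed
  have "AE x in M. (?Y x)\<^sup>2 \<le> (LINT t|lborel. p t * (V t x)\<^sup>2)"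
    using AE_integrable_snd[OF i] AE_space
  proof eventually_elim
    case (elim x)
    have [measurable]: "(\<lambda>t. V t x) \<in> borel_measurable lborel"
      using measurable_compose[OF measurable_Pair2'[OF elim(2)] Vm] by simp
    \<comment> \<open>Almost every path has an integrable weighted square; |V| \<le> 1 + V^2 then
      controls the weighted path itself.\<close>
    have iV: "integrable lborel (\<lambda>t. V t x * p t)"
    proof (rule integrable_dominated[OF Bochner_Integration.integrable_add[OF p elim(1)]])
      fix t
      have "\<bar>V t x\<bar> \<le> 1 + (V t x)\<^sup>2"
        using sum_squares_bound[of 1 "\<bar>V t x\<bar>"] by simp
      from mult_left_mono[OF this p0[of t]] p0[of t]
      show "norm (V t x * p t) \<le> p t + p t * (V t x)\<^sup>2" by (simp add: abs_mult algebra_simps)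
    qed measurable
    \<comment> \<open>The variance of the path under the density p, expanded around its average,
      yields Jensen's inequality.\<close>
    have "0 \<le> (LINT t|lborel. p t * (V t x - ?Y x)\<^sup>2)"
      by (rule integral_nonneg_AE) (use p0 in simp)
    also have "\<dots> = (LINT t|lborel. p t * (V t x)\<^sup>2 - 2 * ?Y x * (V t x * p t) + (?Y x)\<^sup>2 * p t)"
      by (intro Bochner_Integration.integral_cong refl) (simp add: power2_diff algebra_simps)
    also have "\<dots> = (LINT t|lborel. p t * (V t x)\<^sup>2) - 2 * ?Y x * ?Y x + (?Y x)\<^sup>2 * (LINT t|lborel. p t)"
      using elim(1) iV p by simp
    finally show "(?Y x)\<^sup>2 \<le> (LINT t|lborel. p t * (V t x)\<^sup>2)"
      by (simp add: p1 power2_eq_square)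
  qed
  then have "integrable M (\<lambda>x. (?Y x)\<^sup>2)"
    using m integrable_snd[OF i]
    by (intro Bochner_Integration.integrable_bound[OF integrable_snd[OF i]]) auto
  then show ?thesis using m by (simp add: square_integrable_def)
qed

end

section \<open>The covariance kernel\<close>

lemma integrable_exp_decay_half_line:
  fixes F :: "real \<Rightarrow> 'b :: euclidean_space"
  assumes cont: "continuous_on UNIV F" and c: "c > 0"
    and b: "\<And>t. t \<ge> 0 \<Longrightarrow> norm (F t) \<le> D * exp (- c * t)"
  shows "integrable lborel (\<lambda>t. indicator {0..} t *\<^sub>R F t)"
proof -
  have F: "F \<in> borel_measurable borel" using cont by (rule borel_measurable_continuous_onI)
  have "integrable lborel (\<lambda>t. indicator {0<..} t *\<^sub>R exp (- (t * c)))"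
    using integrable_I0i_exp_mscale[OF c] by (simp add: set_integrable_def)
  then have "integrable lborel (\<lambda>t. indicator {0..} t * exp (- c * t))"
  proof (rule integrable_cong_AE_imp)
    show "AE t in lborel. indicator {0<..} t *\<^sub>R exp (- (t * c)) = indicator {0..} t * exp (- c * t)"
      using AE_lborel_singleton[of "0::real"]
      by eventually_elim (auto simp: mult.commute split: split_indicator)
  qed measurable
  from integrable_mult_right[OF this, of D] show ?thesis
  proof (rule integrable_dominated)
    show "(\<lambda>t. indicator {0..} t *\<^sub>R F t) \<in> borel_measurable lborel" using F by measurable
    show "norm (indicator {0..} t *\<^sub>R F t) \<le> D * (indicator {0..} t * exp (- c * t))" for t
      using b[of t] by (cases "t \<ge> 0") auto
  qed
qed

lemma mexp_transpose_scaleR: "mexp (t *\<^sub>R transpose A) = transpose (mexp (t *\<^sub>R A))"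
  by (simp only: transpose_scalar[symmetric] mexp_transpose)

lemma bounded_linear_inner_matrix: "bounded_linear (\<lambda>X. (a :: real ^ 'a) \<bullet> (X *v (w :: real ^ 'b)))"
  by (rule bounded_linear_compose[OF bounded_linear_inner_right
        bounded_bilinear.bounded_linear_left[OF bounded_bilinear_matrix_vector]])

text \<open>Two instances occur. With \<open>w = B *v \<gamma>\<close> it is the kernel between
  drift and noise, zero at negative lag because v depends on past noise only. With
  \<open>w = stationary_cov A B *v a\<close> it is the right half of the stationary
  autocovariance.\<close>

definition exp_kernel :: "real ^ 'd ^ 'd \<Rightarrow> real ^ 'd \<Rightarrow> real ^ 'd \<Rightarrow> real \<Rightarrow> real" where
  "exp_kernel A a w t = indicator {0..} t * (a \<bullet> (mexp (t *\<^sub>R A) *v w))"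

definition stationary_autocov :: "real ^ 'd ^ 'd \<Rightarrow> real ^ 'm ^ 'd \<Rightarrow> real ^ 'd \<Rightarrow> real \<Rightarrow> real" where
  "stationary_autocov A B a t = a \<bullet> (mexp (\<bar>t\<bar> *\<^sub>R A) *v (stationary_cov A B *v a))"

context
  fixes A :: "real ^ 'd ^ 'd"
  assumes st: "stable_matrix A"
begin

lemma mexp_cos_integrable:
  "integrable lborel (\<lambda>t. indicator {0..} t *\<^sub>R (cos (\<omega> * t) *\<^sub>R mexp (t *\<^sub>R A)))"
proof -
  obtain C c where c: "c > 0" "C \<ge> 0" "\<And>t. t \<ge> 0 \<Longrightarrow> norm (mexp (t *\<^sub>R A)) \<le> C * exp (- c * t)"
    using stable_matrix_decay[OF st] by blast
  show ?thesis
  proof (rule integrable_exp_decay_half_line[OF _ c(1)])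
    show "continuous_on UNIV (\<lambda>t. cos (\<omega> * t) *\<^sub>R mexp (t *\<^sub>R A))"
      by (intro continuous_intros continuous_mexp)
    fix t :: real assume "t \<ge> 0"
    have "norm (cos (\<omega> * t) *\<^sub>R mexp (t *\<^sub>R A)) \<le> 1 * norm (mexp (t *\<^sub>R A))"
      unfolding norm_scaleR by (intro mult_right_mono) simp_all
    with c(3)[OF \<open>t \<ge> 0\<close>] show "norm (cos (\<omega> * t) *\<^sub>R mexp (t *\<^sub>R A)) \<le> C * exp (- c * t)" by simp
  qed
qed

lemma exp_kernel_integrable: "integrable lborel (exp_kernel A a w)"
  using integrable_bounded_linear[OF bounded_linear_inner_matrix mexp_cos_integrable[of 0], of a w]
  by (simp add: exp_kernel_def[abs_def] linear_scale[OF bounded_linear.linear[OF bounded_linear_inner_matrix]])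

text \<open>Adding the values at \<omega> and -\<omega> turns the exponentials into
  \<open>2 cos (\<omega> t)\<close>. The linear functional given by a and w commutes with the
  integral, and undoing the factor 1/\<pi> of \<open>cosine_transform\<close> produces
  2\<pi>.\<close>

lemma fourier_exp_kernel:
  "fourier (exp_kernel A a w) \<omega> + fourier (exp_kernel A a w) (- \<omega>) =
     of_real (2 * pi * (a \<bullet> (cosine_transform A \<omega> *v w)))"
proof -
  let ?f = "exp_kernel A a w"
  have "fourier ?f \<omega> + fourier ?f (- \<omega>) =
     (LINT t|lborel. of_real (?f t) * exp (- \<i> * of_real \<omega> * of_real t) + of_real (?f t) * exp (- \<i> * of_real (- \<omega>) * of_real t))"
    unfolding fourier_def
    by (rule Bochner_Integration.integral_add[symmetric]) (rule fourier_integrable[OF exp_kernel_integrable])+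
  also have "\<dots> = (LINT t|lborel. complex_of_real (2 * (a \<bullet> ((indicator {0..} t *\<^sub>R (cos (\<omega> * t) *\<^sub>R mexp (t *\<^sub>R A))) *v w))))"
  proof (intro Bochner_Integration.integral_cong refl)
    fix t
    have "exp (- \<i> * of_real \<omega> * of_real t) + exp (- \<i> * of_real (- \<omega>) * of_real t) = complex_of_real (2 * cos (\<omega> * t))"
      using cos_exp_eq[of "of_real (\<omega> * t)"] by (simp add: cos_of_real[symmetric] mult.assoc add.commute mult.commute[of 2])
    then have "of_real (?f t) * exp (- \<i> * of_real \<omega> * of_real t) + of_real (?f t) * exp (- \<i> * of_real (- \<omega>) * of_real t)
      = of_real (?f t) * complex_of_real (2 * cos (\<omega> * t))" by (simp only: distrib_left[symmetric])
    also have "\<dots> = complex_of_real (2 * (a \<bullet> ((indicator {0..} t *\<^sub>R (cos (\<omega> * t) *\<^sub>R mexp (t *\<^sub>R A))) *v w)))"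
      by (simp only: exp_kernel_def linear_scale[OF bounded_linear.linear[OF bounded_linear_inner_matrix]]) simp
    finally show "of_real (?f t) * exp (- \<i> * of_real \<omega> * of_real t) + of_real (?f t) * exp (- \<i> * of_real (- \<omega>) * of_real t)
      = complex_of_real (2 * (a \<bullet> ((indicator {0..} t *\<^sub>R (cos (\<omega> * t) *\<^sub>R mexp (t *\<^sub>R A))) *v w)))" .
  qed
  also have "\<dots> = of_real (2 * (LINT t|lborel. a \<bullet> ((indicator {0..} t *\<^sub>R (cos (\<omega> * t) *\<^sub>R mexp (t *\<^sub>R A))) *v w)))"
    by (simp only: integral_complex_of_real integral_mult_right_zero)
  also have "(LINT t|lborel. a \<bullet> ((indicator {0..} t *\<^sub>R (cos (\<omega> * t) *\<^sub>R mexp (t *\<^sub>R A))) *v w)) =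
     a \<bullet> ((LINT t|lborel. indicator {0..} t *\<^sub>R (cos (\<omega> * t) *\<^sub>R mexp (t *\<^sub>R A))) *v w)"
    by (rule integral_bounded_linear[OF bounded_linear_inner_matrix mexp_cos_integrable])
  also have "(LINT t|lborel. indicator {0..} t *\<^sub>R (cos (\<omega> * t) *\<^sub>R mexp (t *\<^sub>R A))) = pi *\<^sub>R cosine_transform A \<omega>"
    by (simp add: cosine_transform_def set_lebesgue_integral_def)
  also have "a \<bullet> ((pi *\<^sub>R cosine_transform A \<omega>) *v w) = pi * (a \<bullet> (cosine_transform A \<omega> *v w))"
    by (simp only: linear_scale[OF bounded_linear.linear[OF bounded_linear_inner_matrix]]) simp
  finally show ?thesis by (simp add: mult.assoc)
qed

lemma stationary_cov_integrable:
  "integrable lborel (\<lambda>t. indicator {0..} t *\<^sub>R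
     (mexp (t *\<^sub>R A) ** B ** transpose B ** mexp (t *\<^sub>R transpose A)))"
proof -
  obtain C c where c: "c > 0" "C \<ge> 0" "\<And>t. t \<ge> 0 \<Longrightarrow> norm (mexp (t *\<^sub>R A)) \<le> C * exp (- c * t)"
    using stable_matrix_decay[OF st] by blast
  obtain K where K: "K > 0" "\<And>(X :: real ^ 'd ^ 'd) (Y :: real ^ 'd ^ 'd). norm (X ** Y) \<le> norm X * norm Y * K"
    using bounded_bilinear.pos_bounded[OF bounded_bilinear_matrix_mult] by blast
  obtain L where L: "L > 0" "\<And>X :: real ^ 'd ^ 'd. norm (transpose X) \<le> norm X * L"
    using bounded_linear.pos_bounded[OF bounded_linear_transpose] by blast
  let ?G = "B ** transpose B"
  show ?thesis
  proof (rule integrable_exp_decay_half_line[OF _ c(1)])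
    have *: "mexp (t *\<^sub>R A) ** B ** transpose B ** mexp (t *\<^sub>R transpose A)
        = (mexp (t *\<^sub>R A) ** ?G) ** transpose (mexp (t *\<^sub>R A))" for t
      by (simp only: mexp_transpose_scaleR matrix_mul_assoc)
    show "continuous_on UNIV (\<lambda>t. mexp (t *\<^sub>R A) ** B ** transpose B ** mexp (t *\<^sub>R transpose A))"
      unfolding *
      by (intro bounded_bilinear.continuous_on[OF bounded_bilinear_matrix_mult]
          bounded_linear.continuous_on[OF bounded_linear_transpose] continuous_mexp continuous_on_const)
    fix t :: real assume t: "t \<ge> 0"
    let ?n = "norm (mexp (t *\<^sub>R A))"
    have "norm (mexp (t *\<^sub>R A) ** B ** transpose B ** mexp (t *\<^sub>R transpose A))
      \<le> norm (mexp (t *\<^sub>R A) ** ?G) * norm (transpose (mexp (t *\<^sub>R A))) * K"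
      unfolding * by (rule K)
    also have "\<dots> \<le> (?n * norm ?G * K) * (?n * L) * K"
      using K L by (intro mult_right_mono mult_mono) auto
    \<comment> \<open>One exponential factor already supplies the decay, so the transposed one is
      only bounded by the constant C.\<close>
    also have "\<dots> \<le> (?n * norm ?G * K) * (C * L) * K"
    proof (intro mult_right_mono mult_left_mono)
      have "C * exp (- c * t) \<le> C * 1" using c t by (intro mult_left_mono) auto
      with c(3)[OF t] show "?n \<le> C" by simp
    qed (use K L in auto)
    also have "\<dots> = ?n * (norm ?G * K * C * L * K)" by simp
    also have "\<dots> \<le> (C * exp (- c * t)) * (norm ?G * K * C * L * K)"
      using c K L by (intro mult_right_mono c(3)[OF t]) auto
    also have "\<dots> = (C * norm ?G * K * C * L * K) * exp (- c * t)" by simp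
    finally show "norm (mexp (t *\<^sub>R A) ** B ** transpose B ** mexp (t *\<^sub>R transpose A)) \<le> \<dots>" .
  qed
qed

lemma stationary_autocov_measurable: "stationary_autocov A B a \<in> borel_measurable borel"
proof (rule borel_measurable_continuous_onI)
  have "continuous_on UNIV (\<lambda>t :: real. mexp (\<bar>t\<bar> *\<^sub>R A))"
    by (rule continuous_on_compose2[OF continuous_mexp]) (auto intro!: continuous_intros)
  then show "continuous_on UNIV (stationary_autocov A B a)"
    unfolding stationary_autocov_def[abs_def]
    by (rule bounded_linear.continuous_on[OF bounded_linear_inner_matrix])
qed

text \<open>The two sides differ at \<open>t = 0\<close>, where both half-line kernels contribute.\<close>

lemma stationary_autocov_AE:
  "AE t in lborel. exp_kernel A a (stationary_cov A B *v a) t + exp_kernel A a (stationary_cov A B *v a) (- t)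
     = stationary_autocov A B a t"
  using AE_lborel_singleton[of "0::real"]
proof eventually_elim
  case (elim t)
  then show ?case by (cases "t > 0") (simp_all add: exp_kernel_def stationary_autocov_def)
qed

lemma exp_kernel_reflect_integrable: "integrable lborel (\<lambda>t. exp_kernel A a w (- t))"
  using lborel_integrable_real_affine[OF exp_kernel_integrable[of a w], of "-1" 0] by simp

lemma stationary_autocov_integrable: "integrable lborel (stationary_autocov A B a)"
  by (rule integrable_cong_AE_imp[OF Bochner_Integration.integrable_add[OF exp_kernel_integrable
          exp_kernel_reflect_integrable] _ stationary_autocov_AE])
     (simp add: stationary_autocov_measurable)

text \<open>Almost everywhere this is a half-line kernel plus its reflection, and reflection changes
  the sign of \<omega>; the sum is the one computed in \<open>fourier_exp_kernel\<close>.\<close>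

lemma fourier_stationary_autocov:
  "fourier (stationary_autocov A B a) \<omega> =
     of_real (2 * pi * (a \<bullet> (cosine_transform A \<omega> *v (stationary_cov A B *v a))))"
proof -
  let ?k = "exp_kernel A a (stationary_cov A B *v a)"
  have [measurable]: "?k \<in> borel_measurable borel" "(\<lambda>t. ?k (- t)) \<in> borel_measurable borel"
    using borel_measurable_integrable[OF exp_kernel_integrable]
      borel_measurable_integrable[OF exp_kernel_reflect_integrable] by simp_all
  note [measurable] = stationary_autocov_measurable
  have "fourier (stationary_autocov A B a) \<omega> = fourier (\<lambda>t. ?k t + ?k (- t)) \<omega>"
    unfolding fourier_def
  proof (rule integral_cong_AE)
    show "AE t in lborel. of_real (stationary_autocov A B a t) * exp (- \<i> * of_real \<omega> * of_real t) =
       of_real (?k t + ?k (- t)) * exp (- \<i> * of_real \<omega> * of_real t)"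
      using stationary_autocov_AE[of a B] by eventually_elim simp
  qed measurable
  then show ?thesis
    by (simp only: fourier_add[OF exp_kernel_integrable exp_kernel_reflect_integrable] fourier_reflect
        fourier_exp_kernel)
qed

end

section \<open>The mollified process\<close>

lemma mat_scaleR_vector: "mat c *v \<gamma> = c *\<^sub>R (\<gamma> :: real ^ 'n)"
  by (simp add: vec_eq_iff matrix_vector_mult_def mat_def if_distrib[where f="\<lambda>x. x * _"] cong: if_cong)

lemma noise_covariance:
  assumes bm: "brownian_motion M W"
    and Y: "has_wiener_integral M W (\<lambda>s. mat (q s)) Y" and Z: "has_wiener_integral M W (\<lambda>s. mat (p s)) Z"
  shows "(LINT x|M. (\<gamma> \<bullet> Y x) * (\<gamma> \<bullet> Z x)) = (norm \<gamma>)\<^sup>2 * (LINT u|lborel. q u * p u)"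
proof -
  have "(LINT x|M. (\<gamma> \<bullet> Y x) * (\<gamma> \<bullet> Z x)) =
      (LINT u|lborel. (transpose (mat (q u)) *v \<gamma>) \<bullet> (transpose (mat (p u)) *v \<gamma>))"
    by (rule wiener_covariance[OF bm Y Z])
  also have "\<dots> = (LINT u|lborel. (norm \<gamma>)\<^sup>2 * (q u * p u))"
    by (intro Bochner_Integration.integral_cong refl)
       (simp add: transpose_mat mat_scaleR_vector power2_norm_eq_inner)
  finally show ?thesis by (simp only: integral_mult_right_zero)
qed

context
  fixes M :: "'w measure" and W :: "real \<Rightarrow> 'w \<Rightarrow> real ^ 'm"
    and A :: "real ^ 'd ^ 'd" and B :: "real ^ 'm ^ 'd" and v :: "real \<Rightarrow> 'w \<Rightarrow> real ^ 'd"
  assumes bm: "brownian_motion M W" and sol: "stationary_solution M W A B v"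
begin

lemma stationary_wiener:
  "has_wiener_integral M W (\<lambda>s. indicator {..t} s *\<^sub>R (mexp ((t - s) *\<^sub>R A) ** B)) (v t)"
  using sol unfolding stationary_solution_def by (elim conjE) (erule spec)

text \<open>Only noise before t is common to both variables. With time measured backwards from t,
  the semigroup law pulls \<open>mexp ((s - t) *\<^sub>R A)\<close> out of the integrand, and the
  integral defining \<open>stationary_cov\<close> remains.\<close>

lemma stationary_covariance_ordered:
  assumes st: "stable_matrix A" and "t \<le> s"
  shows "(LINT x|M. (a \<bullet> v s x) * (a \<bullet> v t x)) = stationary_autocov A B a (s - t)"
proof -
  let ?F = "\<lambda>t s. indicator {..t} s *\<^sub>R (mexp ((t - s) *\<^sub>R A) ** B)"
  let ?S = "\<lambda>u. indicator {0..} u *\<^sub>R (mexp (u *\<^sub>R A) ** B ** transpose B ** mexp (u *\<^sub>R transpose A))"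
  have "(LINT x|M. (a \<bullet> v s x) * (a \<bullet> v t x)) =
      (LINT u|lborel. (transpose (?F s u) *v a) \<bullet> (transpose (?F t u) *v a))"
    by (rule wiener_covariance[OF bm stationary_wiener stationary_wiener])
  also have "\<dots> = (LINT u|lborel. (transpose (?F s (t - u)) *v a) \<bullet> (transpose (?F t (t - u)) *v a))"
    by (subst lborel_integral_real_affine[where c="-1" and t=t]) simp_all
  also have "\<dots> = (LINT u|lborel. a \<bullet> ((mexp ((s - t) *\<^sub>R A) ** ?S u) *v a))"
  proof (intro Bochner_Integration.integral_cong refl)
    fix u
    show "(transpose (?F s (t - u)) *v a) \<bullet> (transpose (?F t (t - u)) *v a)
      = a \<bullet> ((mexp ((s - t) *\<^sub>R A) ** ?S u) *v a)"
    proof (cases "u \<ge> 0")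
      case True
      let ?E = "mexp ((s - t) *\<^sub>R A)" and ?U = "mexp (u *\<^sub>R A)"
      have F: "?F s (t - u) = ?E ** ?U ** B" "?F t (t - u) = ?U ** B"
        using True assms mexp_add[of "s - t" u A] by (simp_all add: algebra_simps)
      have "(transpose (?E ** ?U ** B) *v a) \<bullet> (transpose (?U ** B) *v a)
          = a \<bullet> ((?E ** ?U ** B) *v (transpose (?U ** B) *v a))"
        by (simp add: dot_lmul_matrix)
      also have "\<dots> = a \<bullet> ((?E ** (?U ** B ** transpose B ** transpose ?U)) *v a)"
        by (simp only: matrix_vector_mul_assoc matrix_transpose_mul matrix_mul_assoc)
      finally show ?thesis using True unfolding F by (simp add: mexp_transpose_scaleR)
    next
      case False
      then have "?F t (t - u) = 0" by simp
      then show ?thesis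
        using False by (simp add: linear_0[OF bounded_linear.linear[OF bounded_linear_transpose_vector]])
    qed
  qed
  also have "\<dots> = a \<bullet> ((mexp ((s - t) *\<^sub>R A) ** (LINT u|lborel. ?S u)) *v a)"
    by (rule integral_bounded_linear[OF bounded_linear_compose[OF bounded_linear_inner_matrix
            bounded_bilinear.bounded_linear_right[OF bounded_bilinear_matrix_mult]]
          stationary_cov_integrable[OF st]])
  also have "\<dots> = stationary_autocov A B a (s - t)"
    using assms
    by (simp add: stationary_autocov_def stationary_cov_def set_lebesgue_integral_def matrix_vector_mul_assoc)
  finally show ?thesis .
qed

lemma stationary_covariance:
  assumes st: "stable_matrix A"
  shows "(LINT x|M. (a \<bullet> v s x) * (a \<bullet> v t x)) = stationary_autocov A B a (s - t)"
proof (cases "t \<le> s")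
  case False
  then have "(LINT x|M. (a \<bullet> v t x) * (a \<bullet> v s x)) = stationary_autocov A B a (t - s)"
    by (intro stationary_covariance_ordered[OF st]) simp
  then show ?thesis by (simp add: stationary_autocov_def mult.commute abs_minus_commute)
qed (rule stationary_covariance_ordered[OF st])

lemma stationary_noise_covariance:
  assumes Z: "has_wiener_integral M W (\<lambda>s. mat (p s)) Z"
  shows "(LINT x|M. (a \<bullet> v s x) * (\<gamma> \<bullet> Z x)) = (LINT u|lborel. p u * exp_kernel A a (B *v \<gamma>) (s - u))"
proof -
  let ?F = "\<lambda>u. indicator {..s} u *\<^sub>R (mexp ((s - u) *\<^sub>R A) ** B)"
  have "(LINT x|M. (a \<bullet> v s x) * (\<gamma> \<bullet> Z x)) =
      (LINT u|lborel. (transpose (?F u) *v a) \<bullet> (transpose (mat (p u)) *v \<gamma>))"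
    by (rule wiener_covariance[OF bm stationary_wiener Z])
  also have "\<dots> = (LINT u|lborel. p u * exp_kernel A a (B *v \<gamma>) (s - u))"
  proof (intro Bochner_Integration.integral_cong refl)
    fix u
    have "transpose (mat (p u)) *v \<gamma> = p u *\<^sub>R \<gamma>"
      by (simp add: transpose_mat mat_scaleR_vector)
    moreover have "(transpose (?F u) *v a) \<bullet> \<gamma> = exp_kernel A a (B *v \<gamma>) (s - u)"
    proof (cases "u \<le> s")
      case True
      have "(transpose (?F u) *v a) \<bullet> \<gamma> = a \<bullet> (?F u *v \<gamma>)" by (simp add: dot_lmul_matrix)
      with True show ?thesis by (simp add: exp_kernel_def matrix_vector_mul_assoc)
    next
      case False
      then have "?F u = 0" by simp
      with False show ?thesis
        by (simp add: exp_kernel_def linear_0[OF bounded_linear.linear[OF bounded_linear_transpose_vector]])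
    qed
    ultimately show "(transpose (?F u) *v a) \<bullet> (transpose (mat (p u)) *v \<gamma>) = p u * exp_kernel A a (B *v \<gamma>) (s - u)"
      by simp
  qed
  finally show ?thesis .
qed

lemma stationary_mean: "(LINT x|M. a \<bullet> v t x) = 0"
  by (rule wiener_mean[OF bm stationary_wiener])

lemma stationary_square_integrable: "square_integrable M (\<lambda>x. a \<bullet> v t x)"
  by (rule square_integrable_inner_left[OF wiener_square_integrable(2)[OF stationary_wiener]])

lemma stationary_jointly_measurable:
  "(\<lambda>(t, x). a \<bullet> v t x) \<in> borel_measurable (lborel \<Otimes>\<^sub>M M)"
proof (rule continuous_process_measurable)
  show "(\<lambda>x. a \<bullet> v t x) \<in> borel_measurable M" for t
    by (rule square_integrable_measurable[OF stationary_square_integrable])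
  have "\<forall>x\<in>space M. continuous_on UNIV (\<lambda>t. v t x)"
    using sol unfolding stationary_solution_def by (elim conjE)
  then show "continuous_on UNIV (\<lambda>t. a \<bullet> v t x)" if "x \<in> space M" for x
    using that by (intro continuous_on_inner continuous_on_const) (rule bspec)
qed

end

section \<open>The covariance of the mollified process as a sum of convolutions\<close>

text \<open>Two affine substitutions. That s and t survive only in \<open>s - t\<close> is the
  source of stationarity after mollification.\<close>

lemma double_average:
  "(LINT x|lborel. p (s - x) * (LINT y|lborel. p (t - y) * f (x - y))) =
     convolve p (convolve (\<lambda>y. p (- y)) f) (s - t)"
proof -
  have "(LINT y|lborel. p (t - y) * f (x - y)) = convolve (\<lambda>y. p (- y)) f (x - t)" for x
    using lborel_integral_real_affine[of 1 "\<lambda>y. p (t - y) * f (x - y)" t]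
    by (simp add: convolve_def algebra_simps)
  then show ?thesis
    using lborel_integral_real_affine[of "-1" "\<lambda>x. p (s - x) * convolve (\<lambda>y. p (- y)) f (x - t)" s]
    by (simp add: convolve_def[of p] algebra_simps)
qed

text \<open>The pair in h stands for the two mixed covariances of drift and noise;
  \<open>convolve p q\<close> is the autocorrelation of p, the smoothed point mass of the white
  noise.\<close>

definition mollified_autocov ::
  "real ^ 'd ^ 'd \<Rightarrow> real ^ 'm ^ 'd \<Rightarrow> real ^ 'd \<Rightarrow> real ^ 'm \<Rightarrow> (real \<Rightarrow> real) \<Rightarrow> real \<Rightarrow> real" where
  "mollified_autocov A B a \<gamma> p \<tau> =
     (let q = (\<lambda>y. p (- y)); h = convolve p (convolve q (exp_kernel A a (B *v \<gamma>))) in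
      convolve p (convolve q (stationary_autocov A B a)) \<tau> + (h \<tau> + h (- \<tau>))
        + (norm \<gamma>)\<^sup>2 * convolve p q \<tau>)"

context
  fixes M :: "'w measure" and W :: "real \<Rightarrow> 'w \<Rightarrow> real ^ 'm"
    and A :: "real ^ 'd ^ 'd" and B :: "real ^ 'm ^ 'd" and v :: "real \<Rightarrow> 'w \<Rightarrow> real ^ 'd"
    and a :: "real ^ 'd" and \<gamma> :: "real ^ 'm"
    and p :: "real \<Rightarrow> real" and Z :: "real \<Rightarrow> 'w \<Rightarrow> real ^ 'm" and X :: "real \<Rightarrow> 'w \<Rightarrow> real"
  assumes bm: "brownian_motion M W" and st: "stable_matrix A"
    and sol: "stationary_solution M W A B v"
    and p_int: "integrable lborel p" and p_nonneg: "\<And>t. 0 \<le> p t" and p_one: "(LINT t|lborel. p t) = 1"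
    and Z: "\<And>t. has_wiener_integral M W (\<lambda>s. mat (p (t - s))) (Z t)"
    and X_meas: "\<And>t. X t \<in> borel_measurable M"
    and X_eq: "\<And>t. AE x in M. X t x = (LINT s|lborel. (a \<bullet> v s x) * p (t - s)) + \<gamma> \<bullet> Z t x"
begin

lemma shifted_weight_integrable: "integrable lborel (\<lambda>s. p (t - s))"
  using lborel_integrable_real_affine[OF p_int, of "-1" t] by simp

lemma shifted_weight_integral: "(LINT s|lborel. p (t - s)) = 1"
  using lborel_integral_real_affine[of "-1" p t] p_one by simp

lemma stationary_variance: "(LINT x|M. (a \<bullet> v t x)\<^sup>2) \<le> stationary_autocov A B a 0"
  using stationary_covariance[OF bm sol st, of a t t] by (simp add: power2_eq_square)

lemmas stationary_average_facts =
  brownian_motion_prob_space[OF bm] stationary_jointly_measurable[OF bm sol] stationary_square_integrable[OF bm sol]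
  stationary_variance shifted_weight_integrable

abbreviation drift_part :: "real \<Rightarrow> 'w \<Rightarrow> real" where
  "drift_part t x \<equiv> LINT s|lborel. (a \<bullet> v s x) * p (t - s)"

lemma drift_part_square_integrable: "square_integrable M (drift_part t)"
  by (rule time_average_square_integrable[OF stationary_average_facts p_nonneg shifted_weight_integral])

lemma noise_part_square_integrable: "square_integrable M (\<lambda>x. \<gamma> \<bullet> Z t x)"
  by (rule square_integrable_inner_left[OF wiener_square_integrable(2)[OF Z]])

lemma drift_part_product:
  assumes "square_integrable M U"
  shows "(LINT x|M. drift_part t x * U x) = (LINT s|lborel. p (t - s) * (LINT x|M. (a \<bullet> v s x) * U x))"
  by (rule time_average_product[OF stationary_average_facts assms])

text \<open>The averaging formula is used twice, once for each drift, with the other factor as the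
  square integrable variable U; evenness of the stationary autocovariance restores the order of the
  arguments.\<close>

lemma drift_part_covariance:
  "(LINT x|M. drift_part s x * drift_part t x) = convolve p (convolve (\<lambda>y. p (- y)) (stationary_autocov A B a)) (s - t)"
proof -
  have "(LINT x|M. (a \<bullet> v r x) * drift_part t x) = (LINT u|lborel. p (t - u) * stationary_autocov A B a (r - u))" for r
  proof -
    have "(LINT x|M. (a \<bullet> v r x) * drift_part t x) = (LINT x|M. drift_part t x * (a \<bullet> v r x))" by (simp only: mult.commute)
    also have "\<dots> = (LINT u|lborel. p (t - u) * (LINT x|M. (a \<bullet> v u x) * (a \<bullet> v r x)))"
      by (rule drift_part_product[OF stationary_square_integrable[OF bm sol]])
    finally show ?thesis
      by (simp only: stationary_covariance[OF bm sol st] stationary_autocov_def abs_minus_commute)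
  qed
  then show ?thesis
    by (simp only: drift_part_product[OF drift_part_square_integrable] double_average)
qed

lemma drift_noise_part_covariance:
  "(LINT x|M. drift_part s x * (\<gamma> \<bullet> Z t x)) = convolve p (convolve (\<lambda>y. p (- y)) (exp_kernel A a (B *v \<gamma>))) (s - t)"
  by (simp only: drift_part_product[OF noise_part_square_integrable] stationary_noise_covariance[OF bm sol Z] double_average)

lemma noise_part_covariance:
  "(LINT x|M. (\<gamma> \<bullet> Z s x) * (\<gamma> \<bullet> Z t x)) = (norm \<gamma>)\<^sup>2 * convolve p (\<lambda>y. p (- y)) (s - t)"
proof -
  have "(LINT u|lborel. p (s - u) * p (t - u)) = convolve p (\<lambda>y. p (- y)) (s - t)"
    using lborel_integral_real_affine[of "-1" "\<lambda>u. p (s - u) * p (t - u)" s]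
    by (simp add: convolve_def algebra_simps)
  then show ?thesis by (simp only: noise_covariance[OF bm Z Z])
qed

lemma mollified_square_integrable: "square_integrable M (X t)"
proof -
  have S: "square_integrable M (\<lambda>x. drift_part t x + \<gamma> \<bullet> Z t x)"
    by (rule square_integrable_add[OF drift_part_square_integrable noise_part_square_integrable])
  have "integrable M (\<lambda>x. (norm (X t x))\<^sup>2)"
  proof (rule integrable_cong_AE_imp[OF square_integrable_norm[OF S]])
    show "(\<lambda>x. (norm (X t x))\<^sup>2) \<in> borel_measurable M" using X_meas[of t] by measurable
    show "AE x in M. (norm (drift_part t x + \<gamma> \<bullet> Z t x))\<^sup>2 = (norm (X t x))\<^sup>2"
      using X_eq[of t] by eventually_elim simp
  qed
  then show ?thesis using X_meas by (simp add: square_integrable_def)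
qed

lemma mollified_mean: "(LINT x|M. X t x) = 0"
proof -
  interpret prob_space M by (rule brownian_motion_prob_space[OF bm])
  have one: "square_integrable M (\<lambda>x. 1 :: real)" by (simp add: square_integrable_def)
  have int: "integrable M f" if "square_integrable M f" for f :: "'w \<Rightarrow> real"
    using integrable_inner_square_integrable[OF that one] by simp
  have "(LINT x|M. X t x) = (LINT x|M. drift_part t x + \<gamma> \<bullet> Z t x)"
    by (rule integral_cong_AE[OF X_meas _ X_eq])
       (rule square_integrable_measurable[OF square_integrable_add[OF drift_part_square_integrable noise_part_square_integrable]])
  also have "\<dots> = (LINT x|M. drift_part t x) + (LINT x|M. \<gamma> \<bullet> Z t x)"
    by (intro Bochner_Integration.integral_add int drift_part_square_integrable noise_part_square_integrable)
  also have "(LINT x|M. drift_part t x) = (LINT s|lborel. p (t - s) * (LINT x|M. (a \<bullet> v s x) * 1))"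
    using drift_part_product[OF one, of t] by simp
  also have "\<dots> = 0" by (simp add: stationary_mean[OF bm sol])
  also have "(LINT x|M. \<gamma> \<bullet> Z t x) = 0" by (rule wiener_mean[OF bm Z])
  finally show ?thesis by simp
qed

text \<open>Expanding the product gives four covariances. For noise at s with drift at t the lag is
  \<open>t - s\<close>, whence the reflected term.\<close>

lemma mollified_covariance: "(LINT x|M. X s x * X t x) = mollified_autocov A B a \<gamma> p (s - t)"
proof -
  let ?U = "\<lambda>t x. \<gamma> \<bullet> Z t x"
  have int: "integrable M (\<lambda>x. f x * g x)" if "square_integrable M f" "square_integrable M g" for f g :: "'w \<Rightarrow> real"
    using integrable_inner_square_integrable[OF that] by simp
  note YZ = drift_part_square_integrable noise_part_square_integrable
  have "(LINT x|M. X s x * X t x) = (LINT x|M. (drift_part s x + ?U s x) * (drift_part t x + ?U t x))"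
  proof (rule integral_cong_AE)
    show "(\<lambda>x. X s x * X t x) \<in> borel_measurable M" using X_meas by measurable
    show "(\<lambda>x. (drift_part s x + ?U s x) * (drift_part t x + ?U t x)) \<in> borel_measurable M"
      by (rule borel_measurable_integrable[OF int[OF square_integrable_add[OF YZ] square_integrable_add[OF YZ]]])
    show "AE x in M. X s x * X t x = (drift_part s x + ?U s x) * (drift_part t x + ?U t x)"
      using X_eq[of s] X_eq[of t] by eventually_elim simp
  qed
  also have "\<dots> = (LINT x|M. (drift_part s x * drift_part t x + (drift_part s x * ?U t x + drift_part t x * ?U s x)) + ?U s x * ?U t x)"
    by (intro Bochner_Integration.integral_cong refl) (simp add: algebra_simps)
  also have "\<dots> = ((LINT x|M. drift_part s x * drift_part t x) + ((LINT x|M. drift_part s x * ?U t x) + (LINT x|M. drift_part t x * ?U s x)))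
       + (LINT x|M. ?U s x * ?U t x)"
    by (simp only: Bochner_Integration.integral_add Bochner_Integration.integrable_add int YZ)
  finally show ?thesis
    by (simp add: drift_part_covariance drift_noise_part_covariance noise_part_covariance mollified_autocov_def Let_def)
qed

lemma mollified_L2_stationary: "L2_stationary_mean_zero M X"
  unfolding L2_stationary_mean_zero_def
  using X_meas mollified_mean square_integrable_norm[OF mollified_square_integrable] by (simp add: mollified_covariance)

lemma autocov_mollified: "autocov M X = mollified_autocov A B a \<gamma> p"
  by (simp add: fun_eq_iff autocov_def mollified_covariance)

end

section \<open>The spectral density and its limit\<close>

text \<open>Each summand is a convolution with p and its reflection, so p enters the transform only
  through a common factor; the remaining bracket is 2\<pi> times the limiting density.\<close>

lemma fourier_mollified_autocov:
  assumes st: "stable_matrix A" and p: "integrable lborel p"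
  shows "integrable lborel (mollified_autocov A B a \<gamma> p)"
    and "fourier (mollified_autocov A B a \<gamma> p) \<omega> = fourier p \<omega> * fourier p (- \<omega>) *
      of_real (2 * pi * (a \<bullet> (cosine_transform A \<omega> *v (stationary_cov A B *v a))
           + a \<bullet> (cosine_transform A \<omega> *v (B *v \<gamma>))) + (norm \<gamma>)\<^sup>2)"
proof -
  let ?q = "\<lambda>y. p (- y)"
  let ?K = "convolve p (convolve ?q (stationary_autocov A B a))"
  let ?h = "convolve p (convolve ?q (exp_kernel A a (B *v \<gamma>)))"
  note sK = stationary_autocov_integrable[OF st, of B a]
  note sh = exp_kernel_integrable[OF st, of a "B *v \<gamma>"]
  have q: "integrable lborel ?q" using lborel_integrable_real_affine[OF p, of "-1" 0] by simp
  have K: "integrable lborel ?K" by (intro convolve_integrable p q sK)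
  have h: "integrable lborel ?h" by (intro convolve_integrable p q sh)
  have h': "integrable lborel (\<lambda>t. ?h (- t))" using lborel_integrable_real_affine[OF h, of "-1" 0] by simp
  have c: "integrable lborel (\<lambda>t. (norm \<gamma>)\<^sup>2 * convolve p ?q t)"
    by (intro integrable_mult_right convolve_integrable p q)
  have eq: "mollified_autocov A B a \<gamma> p = (\<lambda>t. (?K t + (?h t + ?h (- t))) + (norm \<gamma>)\<^sup>2 * convolve p ?q t)"
    by (simp add: fun_eq_iff mollified_autocov_def Let_def)
  show "integrable lborel (mollified_autocov A B a \<gamma> p)"
    unfolding eq by (intro Bochner_Integration.integrable_add K h h' c)
  have "fourier (mollified_autocov A B a \<gamma> p) \<omega> =
     fourier ?K \<omega> + (fourier ?h \<omega> + fourier ?h (- \<omega>)) + of_real ((norm \<gamma>)\<^sup>2) * fourier (convolve p ?q) \<omega>"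
    unfolding eq
    by (simp only: fourier_add K h h' c Bochner_Integration.integrable_add fourier_cmult fourier_reflect)
  \<comment> \<open>The factor in p is unchanged when \<omega> becomes -\<omega>, so it leaves the
    sum and the two kernel transforms combine to a cosine transform.\<close>
  also have "fourier ?h \<omega> + fourier ?h (- \<omega>) = fourier p \<omega> * fourier p (- \<omega>) *
     (fourier (exp_kernel A a (B *v \<gamma>)) \<omega> + fourier (exp_kernel A a (B *v \<gamma>)) (- \<omega>))"
    by (simp add: fourier_convolve convolve_integrable p q sh fourier_reflect algebra_simps)
  also have "fourier ?K \<omega> = fourier p \<omega> * fourier p (- \<omega>) * fourier (stationary_autocov A B a) \<omega>"
    by (simp add: fourier_convolve convolve_integrable p q sK fourier_reflect)
  also have "fourier (convolve p ?q) \<omega> = fourier p \<omega> * fourier p (- \<omega>)"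
    by (simp add: fourier_convolve p q fourier_reflect)
  finally show "fourier (mollified_autocov A B a \<gamma> p) \<omega> = fourier p \<omega> * fourier p (- \<omega>) *
      of_real (2 * pi * (a \<bullet> (cosine_transform A \<omega> *v (stationary_cov A B *v a))
           + a \<bullet> (cosine_transform A \<omega> *v (B *v \<gamma>))) + (norm \<gamma>)\<^sup>2)"
    unfolding fourier_exp_kernel[OF st] fourier_stationary_autocov[OF st]
    by (simp add: algebra_simps)
qed

lemma mollifier_properties:
  assumes "mollifier \<psi>"
  shows "\<And>t. 0 \<le> \<psi> t" "\<And>t. t \<notin> {-1..1} \<Longrightarrow> \<psi> t = 0" "(LINT t|lborel. \<psi> t) = 1" "integrable lborel \<psi>"
proof -
  show "0 \<le> \<psi> t" "t \<notin> {-1..1} \<Longrightarrow> \<psi> t = 0" for t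
    using assms unfolding mollifier_def by blast+
  show "(LINT t|lborel. \<psi> t) = 1" using assms unfolding mollifier_def by blast
  \<comment> \<open>A non-integrable function has Bochner integral 0, so the value 1 forces
    integrability.\<close>
  then show "integrable lborel \<psi>" using not_integrable_integral_eq[of lborel \<psi>] by fastforce
qed

lemma mollified_process_psd:
  assumes bm: "brownian_motion M W" and st: "stable_matrix A" and sol: "stationary_solution M W A B v"
    and \<psi>: "mollifier \<psi>" and \<xi>: "mollified_process M W v a \<gamma> \<psi> \<xi>" and \<delta>: "\<delta> > 0"
  shows "psd_well_defined M (\<xi> \<delta>)"
    and "psd M (\<xi> \<delta>) \<omega> = fourier (rescale \<psi> \<delta>) \<omega> * fourier (rescale \<psi> \<delta>) (- \<omega>) *
      of_real (a \<bullet> (cosine_transform A \<omega> *v (stationary_cov A B *v a))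
           + a \<bullet> (cosine_transform A \<omega> *v (B *v \<gamma>)) + (norm \<gamma>)\<^sup>2 / (2 * pi))"
proof -
  note \<psi> = mollifier_properties[OF \<psi>]
  let ?p = "rescale \<psi> \<delta>"
  have p: "integrable lborel ?p" by (rule rescale_integrable[OF \<psi>(4) \<delta>])
  have p0: "0 \<le> ?p t" for t using \<psi>(1) \<delta> by (simp add: rescale_def)
  have p1: "(LINT t|lborel. ?p t) = 1"
    using lborel_integral_real_affine[of "1 / \<delta>" \<psi> 0] \<psi>(3) \<delta> by (simp add: rescale_def)
  have *: "\<forall>t. \<xi> \<delta> t \<in> borel_measurable M \<and>
        (\<exists>Z. has_wiener_integral M W (\<lambda>s. mat (?p (t - s))) Z \<and>
           (AE x in M. \<xi> \<delta> t x = (LINT s|lborel. (a \<bullet> v s x) * ?p (t - s)) + \<gamma> \<bullet> Z x))"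
    using \<xi> \<delta> unfolding mollified_process_def by blast
  then have "\<forall>t. \<exists>Z. has_wiener_integral M W (\<lambda>s. mat (?p (t - s))) Z \<and>
           (AE x in M. \<xi> \<delta> t x = (LINT s|lborel. (a \<bullet> v s x) * ?p (t - s)) + \<gamma> \<bullet> Z x)"
    by blast
  \<comment> \<open>The noise integral is granted for each t separately; a version is selected for
    every t, and covariances do not depend on the selection.\<close>
  from choice[OF this] obtain Z where
    Z: "\<forall>t. has_wiener_integral M W (\<lambda>s. mat (?p (t - s))) (Z t) \<and>
           (AE x in M. \<xi> \<delta> t x = (LINT s|lborel. (a \<bullet> v s x) * ?p (t - s)) + \<gamma> \<bullet> Z t x)" by (rule exE)
  note X = bm st sol p p0 p1 conjunct1[OF spec[OF Z]] conjunct1[OF spec[OF *]] conjunct2[OF spec[OF Z]]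
  note F = fourier_mollified_autocov[OF st p, where B = B and a = a and \<gamma> = \<gamma>]
  have ac: "autocov M (\<xi> \<delta>) = mollified_autocov A B a \<gamma> ?p"
    by (rule autocov_mollified[OF X])
  show "psd_well_defined M (\<xi> \<delta>)"
    unfolding psd_well_defined_def ac using mollified_L2_stationary[OF X] F(1) by (rule conjI)
  have "psd M (\<xi> \<delta>) \<omega> = 1 / (2 * of_real pi) * fourier (mollified_autocov A B a \<gamma> ?p) \<omega>"
    unfolding psd_def ac fourier_def ..
  then show "psd M (\<xi> \<delta>) \<omega> = fourier (rescale \<psi> \<delta>) \<omega> * fourier (rescale \<psi> \<delta>) (- \<omega>) *
      of_real (a \<bullet> (cosine_transform A \<omega> *v (stationary_cov A B *v a))
           + a \<bullet> (cosine_transform A \<omega> *v (B *v \<gamma>)) + (norm \<gamma>)\<^sup>2 / (2 * pi))"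
    unfolding F(2) by (simp add: field_simps)
qed

text \<open>In the factorised density only the two transforms of the rescaled mollifier depend on
  \<delta>, and both tend to 1.\<close>

lemma tendsto_psd:
  assumes bm: "brownian_motion M W" and st: "stable_matrix A" and sol: "stationary_solution M W A B v"
    and \<psi>: "mollifier \<psi>" and \<xi>: "mollified_process M W v a \<gamma> \<psi> \<xi>"
  shows "((\<lambda>\<delta>. psd M (\<xi> \<delta>) \<omega>) \<longlongrightarrow>
        complex_of_real
          (a \<bullet> (cosine_transform A \<omega> *v (stationary_cov A B *v a))
           + a \<bullet> (cosine_transform A \<omega> *v (B *v \<gamma>)) + (norm \<gamma>)\<^sup>2 / (2 * pi))) (at_right 0)"
    (is "(_ \<longlongrightarrow> ?S) _")
proof -
  note l = tendsto_fourier_rescale[OF mollifier_properties[OF \<psi>]]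
  have "((\<lambda>\<delta>. fourier (rescale \<psi> \<delta>) \<omega> * fourier (rescale \<psi> \<delta>) (- \<omega>) * ?S) \<longlongrightarrow> 1 * 1 * ?S) (at_right 0)"
    by (intro tendsto_mult l tendsto_const)
  moreover have "\<forall>\<^sub>F \<delta> in at_right 0. fourier (rescale \<psi> \<delta>) \<omega> * fourier (rescale \<psi> \<delta>) (- \<omega>) * ?S = psd M (\<xi> \<delta>) \<omega>"
    using eventually_at_right_less[of 0]
    by eventually_elim (rule mollified_process_psd(2)[OF assms, symmetric])
  ultimately show ?thesis by (simp add: tendsto_cong)
qed

theorem proposition5p2:
  fixes M :: "'w measure"
    and W :: "real \<Rightarrow> 'w \<Rightarrow> real ^ 'm"
    and A :: "real ^ 'd ^ 'd" and B :: "real ^ 'm ^ 'd"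
    and a :: "real ^ 'd" and \<gamma> :: "real ^ 'm"
    and v :: "real \<Rightarrow> 'w \<Rightarrow> real ^ 'd"
    and \<psi> :: "real \<Rightarrow> real"
    and \<xi> :: "real \<Rightarrow> real \<Rightarrow> 'w \<Rightarrow> real"
  assumes "brownian_motion M W"
    and "stable_matrix A"
    and "controllable A B"
    and "stationary_solution M W A B v"
    and "mollifier \<psi>"
    and "mollified_process M W v a \<gamma> \<psi> \<xi>"
  shows "(\<forall>\<delta>>0. psd_well_defined M (\<xi> \<delta>)) \<and>
    (\<forall>\<omega>. ((\<lambda>\<delta>. psd M (\<xi> \<delta>) \<omega>) \<longlongrightarrow>
        complex_of_real
          (a \<bullet> (cosine_transform A \<omega> *v (stationary_cov A B *v a))
           + a \<bullet> (cosine_transform A \<omega> *v (B *v \<gamma>)) + (norm \<gamma>)\<^sup>2 / (2 * pi))) (at_right 0)) \<and>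
    (\<forall>\<psi>' \<xi>'. mollifier \<psi>' \<longrightarrow> mollified_process M W v a \<gamma> \<psi>' \<xi>' \<longrightarrow>
        (\<forall>\<omega>. limit_psd M \<xi>' \<omega> = limit_psd M \<xi> \<omega>)) \<and>
    (\<forall>\<omega>. \<omega> \<noteq> 0 \<longrightarrow>
        complex_of_real (lambda2 A B a \<gamma> \<omega>) = complex_of_real (pi / \<omega>\<^sup>2) * limit_psd M \<xi> \<omega>)"
proof -
  note assms' = assms(1,2,4)
  \<comment> \<open>The value contains neither \<psi>' nor \<xi>', so independence of the mollifier
    and the formula for \<open>lambda2\<close> both follow by rewriting.\<close>
  have limit: "limit_psd M \<xi>' \<omega> =
        complex_of_real
          (a \<bullet> (cosine_transform A \<omega> *v (stationary_cov A B *v a))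
           + a \<bullet> (cosine_transform A \<omega> *v (B *v \<gamma>)) + (norm \<gamma>)\<^sup>2 / (2 * pi))"
    if "mollifier \<psi>'" "mollified_process M W v a \<gamma> \<psi>' \<xi>'" for \<psi>' \<xi>' \<omega>
    \<comment> \<open>Convergence determines \<open>Lim\<close> because \<open>at_right 0\<close> is
      a nontrivial filter; that is the goal left to \<open>simp\<close>.\<close>
    unfolding limit_psd_def by (rule tendsto_Lim[OF _ tendsto_psd[OF assms' that]]) simp
  show ?thesis
  proof (intro conjI allI impI)
    show "psd_well_defined M (\<xi> \<delta>)" if "\<delta> > 0" for \<delta>
      by (rule mollified_process_psd(1)[OF assms' assms(5,6) that])
    show "limit_psd M \<xi>' \<omega> = limit_psd M \<xi> \<omega>"
      if "mollifier \<psi>'" "mollified_process M W v a \<gamma> \<psi>' \<xi>'" for \<psi>' \<xi>' \<omega>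
      by (simp only: limit[OF that] limit[OF assms(5,6)])
    show "complex_of_real (lambda2 A B a \<gamma> \<omega>) = complex_of_real (pi / \<omega>\<^sup>2) * limit_psd M \<xi> \<omega>" for \<omega>
      by (simp only: limit[OF assms(5,6)] lambda2_def of_real_mult)
  qed (rule tendsto_psd[OF assms' assms(5,6)])
qed

end
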